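(* Let $\varrho:[0,1]\to\mathbb{C}$ be integrable, let $0\le x_1<x_2<\dots<x_n\le 1$, and let $N(f)=(f(x_1),\dots,f(x_n))$. Put $x_0=0$, $x_{n+1}=1$ and $I_j=[x_j,x_{j+1}]$ for $j=0,\dots,n$. In the case of $H^1_0([0,1])$ the radius of information is given by $$r(N)=\left(\sum_{j=0}^n e_0(x_j,x_{j+1},\varrho)^2\right)^{1/2}.$$ Moreover, the worst case function $f^*$ is given by $$f^*|_{I_j}=\Big(\sum_{i=0}^n c_i^2\Big)^{-1/2}\cdot c_j\cdot f_j^*,\qquad j=0,\dots,n,$$ where $c_j=e_0(x_j,x_{j+1},\varrho)$. In particular, $f^*\in H^1_0([0,1])$ with norm $1$ and $N(f^* )=0$, with $I_\varrho(f^* )=r(N)$.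
   Context: For an interval $[a,b]$, $H^1_0([a,b])$ is the space of all absolutely continuous $f:[a,b]\to\mathbb{C}$ with $f'\in L_2([a,b])$ and $f(a)=f(b)=0$, with norm $\|f\|:=\|f'\|_{L_2([a,b])}$. Set $I_\varrho(f)=\int_0^1 f(x)\varrho(x)\,dx$ for $f\in H^1_0([0,1])$. The radius of the information $N$ for $H^1_0([0,1])$ is $$r(N)=\sup\{|I_\varrho(f)|: f\in H^1_0([0,1]),\ \|f\|\le 1,\ N(f)=0\};$$ it equals the worst case error, over the unit ball of $H^1_0([0,1])$, of an optimal algorithm of the form $f\mapsto\phi(N(f))$ with $\phi:\mathbb{C}^n\to\mathbb{C}$. The initial error on an interval $[a,b]\subseteq[0,1]$ is $e_0(a,b,\varrho)=\sup\{|\int_a^b f(x)\varrho(x)\,dx| : f\in H^1_0([a,b]),\ \|f\|\le 1\}$. The function $f_j^*\in H^1_0(I_j)$ is the worst case function of norm one on $I_j$, with $\int_{I_j} f_j^*(x)\varrho(x)\,dx=c_j$: with $R_j(t)=\int_{x_j}^t\varrho(x)\,dx$ for $t\in I_j$ and $\beta_j=\frac{1}{x_{j+1}-x_j}\int_{I_j}R_j(x)\,dx$, $$f_j^*(t)=-\int_{x_j}^t\frac{\overline{R_j(x)}-\overline{\beta_j}}{\|R_j-\beta_j\|_{L_2(I_j)}}\,dx,\qquad t\in I_j.$$ *)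

theory Defs
  imports "HOL-Analysis.Analysis"
begin

text \<open>
  Functions on \<^term>\<open>{a..b}\<close> are total functions on the reals of which only the values on
  \<^term>\<open>{a..b}\<close> matter. All integrals are Lebesgue integrals with respect to
  \<^term>\<open>lebesgue_on {a..b}\<close>. The degenerate interval \<open>a = b\<close> is allowed.
\<close>

text \<open>
  The usual epsilon-delta definition. A division of its own union is a finite family of
  compact intervals with pairwise disjoint interiors.
\<close>

definition abs_continuous :: "real \<Rightarrow> real \<Rightarrow> (real \<Rightarrow> complex) \<Rightarrow> bool" where
  "abs_continuous a b f \<longleftrightarrow>
     (\<forall>\<epsilon>>0. \<exists>\<delta>>0. \<forall>D. D division_of \<Union>D \<and> \<Union>D \<subseteq> {a..b} \<and> (\<Sum>K\<in>D. Sup K - Inf K) < \<delta> \<longrightarrow>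
        (\<Sum>K\<in>D. cmod (f (Sup K) - f (Inf K))) < \<epsilon>)"

definition in_L2 :: "real \<Rightarrow> real \<Rightarrow> (real \<Rightarrow> complex) \<Rightarrow> bool" where
  "in_L2 a b g \<longleftrightarrow> g \<in> borel_measurable (lebesgue_on {a..b}) \<and>
     integrable (lebesgue_on {a..b}) (\<lambda>t. (cmod (g t))\<^sup>2)"

definition L2_norm :: "real \<Rightarrow> real \<Rightarrow> (real \<Rightarrow> complex) \<Rightarrow> real" where
  "L2_norm a b g = sqrt (LINT t|lebesgue_on {a..b}. (cmod (g t))\<^sup>2)"

text \<open>
  The value of this function is arbitrary at the points where \<open>f\<close> is not differentiable.
  For the members of \<open>H10\<close> below these points form a null set.
\<close>

definition ae_deriv :: "real \<Rightarrow> real \<Rightarrow> (real \<Rightarrow> complex) \<Rightarrow> real \<Rightarrow> complex" where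
  "ae_deriv a b f t = vector_derivative f (at t within {a..b})"

text \<open>
  Almost everywhere differentiability follows from absolute continuity (Lebesgue). It is
  listed because it is what gives \<open>f' \<in> L\<^sub>2\<close> its meaning.
\<close>

definition H10 :: "real \<Rightarrow> real \<Rightarrow> (real \<Rightarrow> complex) set" where
  "H10 a b = {f. abs_continuous a b f \<and>
     (AE t in lebesgue_on {a..b}. f differentiable (at t within {a..b})) \<and>
     in_L2 a b (ae_deriv a b f) \<and> f a = 0 \<and> f b = 0}"

definition H10_norm :: "real \<Rightarrow> real \<Rightarrow> (real \<Rightarrow> complex) \<Rightarrow> real" where
  "H10_norm a b f = L2_norm a b (ae_deriv a b f)"

definition weighted_integral :: "real \<Rightarrow> real \<Rightarrow> (real \<Rightarrow> complex) \<Rightarrow> (real \<Rightarrow> complex) \<Rightarrow> complex" where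
  "weighted_integral a b \<rho> f = (LINT t|lebesgue_on {a..b}. f t * \<rho> t)"

definition initial_error :: "real \<Rightarrow> real \<Rightarrow> (real \<Rightarrow> complex) \<Rightarrow> real" where
  "initial_error a b \<rho> =
     Sup {cmod (weighted_integral a b \<rho> f) |f. f \<in> H10 a b \<and> H10_norm a b f \<le> 1}"

text \<open>
  Information with values in \<open>\<complex>\<^sup>n\<close> is a map \<open>N\<close> for which only the components
  \<open>N f i\<close> with \<open>1 \<le> i \<le> n\<close> are relevant.
\<close>

definition point_info :: "(nat \<Rightarrow> real) \<Rightarrow> (real \<Rightarrow> complex) \<Rightarrow> nat \<Rightarrow> complex" where
  "point_info x f i = f (x i)"

definition radius :: "(real \<Rightarrow> complex) \<Rightarrow> nat \<Rightarrow> ((real \<Rightarrow> complex) \<Rightarrow> nat \<Rightarrow> complex) \<Rightarrow> real" where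
  "radius \<rho> n N =
     Sup {cmod (weighted_integral 0 1 \<rho> f) |f.
            f \<in> H10 0 1 \<and> H10_norm 0 1 f \<le> 1 \<and> (\<forall>i\<in>{1..n}. N f i = 0)}"

definition primitive :: "real \<Rightarrow> (real \<Rightarrow> complex) \<Rightarrow> real \<Rightarrow> complex" where
  "primitive a \<rho> t = (LINT s|lebesgue_on {a..t}. \<rho> s)"

definition primitive_mean :: "real \<Rightarrow> real \<Rightarrow> (real \<Rightarrow> complex) \<Rightarrow> complex" where
  "primitive_mean a b \<rho> =
     complex_of_real (1 / (b - a)) * (LINT s|lebesgue_on {a..b}. primitive a \<rho> s)"

text \<open>
  If the norm in the denominator is 0, division by zero makes this the zero function. In that
  case the initial error on the interval, by which the function gets multiplied, is 0 as well.
\<close>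

definition local_worst_fun :: "real \<Rightarrow> real \<Rightarrow> (real \<Rightarrow> complex) \<Rightarrow> real \<Rightarrow> complex" where
  "local_worst_fun a b \<rho> t =
     - (LINT s|lebesgue_on {a..t}.
          (cnj (primitive a \<rho> s) - cnj (primitive_mean a b \<rho>)) /
          complex_of_real (L2_norm a b (\<lambda>u. primitive a \<rho> u - primitive_mean a b \<rho>)))"

end

theory Submission
  imports Defs
begin

text \<open>
  For \<open>f\<close> in \<open>H10 a b\<close>, Fubini's theorem turns \<open>\<integral> f \<rho>\<close> into \<open>- \<integral> f' (R - \<beta>)\<close>, where
  \<open>R\<close> is the primitive of \<open>\<rho>\<close> and any constant \<open>\<beta>\<close> may be subtracted because \<open>\<integral> f' = 0\<close>. By
  Cauchy-Schwarz the initial error is at most the \<open>L\<^sub>2\<close> norm of \<open>R - \<beta>\<close>, and for the mean value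
  \<open>\<beta>\<close> the function with derivative proportional to the conjugate of \<open>R - \<beta>\<close> attains it. A function
  that vanishes at all sample points splits into independent pieces, whose squared norms add up, so
  Cauchy-Schwarz for sums gives the bound on the radius, with equality when the local worst case
  functions are weighted proportionally to the local errors.
\<close>

subsection \<open>The fundamental theorem of calculus for absolutely continuous functions\<close>

text \<open>The gauge integral is used because it requires no prior integrability of
  \<open>g\<close>. The increments of \<open>f\<close> over a tagged division telescope to
  \<open>f b - f a\<close>, so it suffices to compare each term of the Riemann sum with one
  increment; each of the two kinds of tags may cost \<open>e / 2\<close>.\<close>

lemma abs_continuous_imp_has_integral:
  assumes ac: "abs_continuous a b f" and "a \<le> b" and E: "negligible E"
    and deriv: "\<And>x. x \<in> {a..b} - E \<Longrightarrow> (f has_vector_derivative g x) (at x within {a..b})"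
  shows "(g has_integral (f b - f a)) {a..b}"
proof -
  \<comment> \<open>With the value 0 on \<open>E\<close>, tags in \<open>E\<close> contribute only
    increments of \<open>f\<close>. The change on a negligible set is undone at the very
    end.\<close>
  define h where "h = (\<lambda>x. if x \<in> E then 0 else g x)"
  have "(h has_integral (f b - f a)) {a..b}"
    unfolding has_integral_real
  proof (intro allI impI)
    fix e :: real
    assume "e > 0"
    \<comment> \<open>This is the slope error allowed at tags outside \<open>E\<close>, so that a
      total length of \<open>b - a\<close> costs at most \<open>e / 2\<close>. The summand 1 keeps
      the denominator positive when \<open>a = b\<close>.\<close>
    define \<eta> where "\<eta> = e / (2 * (b - a + 1))"
    have "\<eta> > 0"
      using \<open>e > 0\<close> \<open>a \<le> b\<close> by (simp add: \<eta>_def)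
    have \<eta>_le: "\<eta> * (b - a) \<le> e / 2"
      using \<open>e > 0\<close> \<open>a \<le> b\<close> by (simp add: \<eta>_def field_simps)
    have "e / 2 > 0"
      using \<open>e > 0\<close> by simp
    from ac[unfolded abs_continuous_def, rule_format, OF this]
    obtain \<delta> where "\<delta> > 0" and \<delta>: "\<forall>D. D division_of \<Union>D \<and> \<Union>D \<subseteq> {a..b} \<and> (\<Sum>K\<in>D. Sup K - Inf K) < \<delta> \<longrightarrow>
        (\<Sum>K\<in>D. cmod (f (Sup K) - f (Inf K))) < e / 2"
      by (elim exE conjE)
    \<comment> \<open>Outer regularity provides an open \<open>T\<close> around \<open>E\<close>
      with \<open>T - E\<close> small; as \<open>E\<close> is null, \<open>T\<close> itself has
      measure less than \<delta>.\<close>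
    have null: "E \<in> null_sets lebesgue"
      using E by (simp add: negligible_iff_null_sets)
    then have "E \<in> sets lebesgue"
      by blast
    then obtain T where "open T" "E \<subseteq> T" "T - E \<in> lmeasurable" "emeasure lebesgue (T - E) < ennreal \<delta>"
      using sets_lebesgue_outer_open[OF _ \<open>\<delta> > 0\<close>] by metis
    have "T = (T - E) \<union> E"
      using \<open>E \<subseteq> T\<close> by blast
    then have "T \<in> lmeasurable"
      using \<open>T - E \<in> lmeasurable\<close> negligible_imp_measurable[OF E] by (metis fmeasurable.Un)
    have "emeasure lebesgue (T - E) = emeasure lebesgue T"
      using null \<open>T \<in> lmeasurable\<close> by (simp add: emeasure_Diff_null_set fmeasurableD)
    then have T_less: "measure lebesgue T < \<delta>"
      using \<open>emeasure lebesgue (T - E) < ennreal \<delta>\<close> \<open>\<delta> > 0\<close>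
      by (simp add: emeasure_eq_measure2 \<open>T \<in> lmeasurable\<close> ennreal_less_iff)
    have "\<exists>d>0. x \<in> {a..b} - E \<longrightarrow>
         (\<forall>y\<in>{a..b}. norm (y-x) < d \<longrightarrow> norm (f y - f x - (y-x) *\<^sub>R g x) \<le> \<eta> * norm (y-x))" for x
    proof (cases "x \<in> {a..b} - E")
      case True
      then show ?thesis
        using deriv[OF True, unfolded has_vector_derivative_def has_derivative_within_alt] \<open>\<eta> > 0\<close>
        by blast
    qed (auto intro: exI[of _ 1])
    then obtain d where d: "\<And>x. 0 < d x"
                 "\<And>x y. \<lbrakk>x \<in> {a..b} - E; y \<in> {a..b}; norm (y-x) < d x\<rbrakk>
                        \<Longrightarrow> norm (f y - f x - (y-x) *\<^sub>R g x) \<le> \<eta> * norm (y-x)"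
      by metis
    \<comment> \<open>Tags outside \<open>E\<close> are handled by differentiability; the intervals with tags in \<open>E\<close> lie
      in the open set \<open>T\<close> of measure less than \<open>\<delta>\<close>, so absolute continuity controls them.\<close>
    define \<gamma> where "\<gamma> = (\<lambda>x. if x \<in> E then T else ball x (d x))"
    have "gauge \<gamma>"
      using d(1) \<open>open T\<close> \<open>E \<subseteq> T\<close> by (auto simp: gauge_def \<gamma>_def)
    moreover have "norm ((\<Sum>(x, K)\<in>p. measure lborel K *\<^sub>R h x) - (f b - f a)) < e"
      if pfine: "p tagged_division_of {a..b} \<and> \<gamma> fine p" for p
    proof -
      have p: "p tagged_division_of {a..b}" and "\<gamma> fine p"
        using pfine by auto
      have "finite p"
        using p by blast
      define p1 where "p1 = {(x, K) \<in> p. x \<in> E}"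
      have "p1 \<subseteq> p"
        by (auto simp: p1_def)
      have interval: "\<exists>u v. K = {u..v} \<and> u \<le> v \<and> x \<in> K \<and> K \<subseteq> {a..b}" if "(x, K) \<in> p" for x K
      proof -
        have "x \<in> K" "K \<subseteq> {a..b}"
          using p that by blast+
        moreover obtain u v where "K = cbox u v"
          using p \<open>(x, K) \<in> p\<close> by blast
        ultimately show ?thesis
          by (intro exI[of _ u] exI[of _ v]) auto
      qed
      have ba: "b - a = (\<Sum>(x,K)\<in>p. Sup K - Inf K)" "f b - f a = (\<Sum>(x,K)\<in>p. f (Sup K) - f (Inf K))"
        using additive_tagged_division_1[OF \<open>a \<le> b\<close> p, of "\<lambda>x. x"]
          additive_tagged_division_1[OF \<open>a \<le> b\<close> p, of f] by auto
      have "(\<Sum>(x, K)\<in>p. measure lborel K *\<^sub>R h x) - (f b - f a)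
          = (\<Sum>(x, K)\<in>p. measure lborel K *\<^sub>R h x - (f (Sup K) - f (Inf K)))"
        unfolding ba(2) by (simp add: split_def sum_subtractf)
      also have "\<dots> = (\<Sum>(x, K)\<in>p1. measure lborel K *\<^sub>R h x - (f (Sup K) - f (Inf K)))
          + (\<Sum>(x, K)\<in>p - p1. measure lborel K *\<^sub>R h x - (f (Sup K) - f (Inf K)))"
        by (subst sum.subset_diff[OF \<open>p1 \<subseteq> p\<close> \<open>finite p\<close>]) (rule add.commute)
      finally have "norm ((\<Sum>(x, K)\<in>p. measure lborel K *\<^sub>R h x) - (f b - f a)) \<le>
          norm (\<Sum>(x, K)\<in>p1. measure lborel K *\<^sub>R h x - (f (Sup K) - f (Inf K)))
          + norm (\<Sum>(x, K)\<in>p - p1. measure lborel K *\<^sub>R h x - (f (Sup K) - f (Inf K)))"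
        by (simp only: norm_triangle_ineq)
      moreover have "norm (\<Sum>(x, K)\<in>p1. measure lborel K *\<^sub>R h x - (f (Sup K) - f (Inf K))) < e / 2"
      proof -
        have "p1 tagged_partial_division_of {a..b}"
          using p \<open>p1 \<subseteq> p\<close> by (auto simp: tagged_division_of_def intro: tagged_partial_division_subset)
        note div = partial_division_of_tagged_division[OF this]
          and tag = tagged_partial_division_of_Union_self[OF this]
        have "(\<Sum>K\<in>snd ` p1. Sup K - Inf K) = (\<Sum>K\<in>snd ` p1. measure lebesgue K)"
        proof (rule sum.cong)
          fix K assume "K \<in> snd ` p1"
          then obtain x where "(x, K) \<in> p"
            using \<open>p1 \<subseteq> p\<close> by auto
          then show "Sup K - Inf K = measure lebesgue K"
            using interval by fastforce
        qed simp
        also have "\<dots> = measure lebesgue (\<Union>(snd ` p1))"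
          by (rule content_division[OF div])
        also have "\<dots> \<le> measure lebesgue T"
        proof (rule measure_mono_fmeasurable)
          show "\<Union>(snd ` p1) \<subseteq> T"
            using \<open>\<gamma> fine p\<close> by (fastforce simp: fine_def p1_def \<gamma>_def)
        qed (use \<open>T \<in> lmeasurable\<close> lmeasurable_division[OF div] in \<open>auto simp: fmeasurableD\<close>)
        also have "\<dots> < \<delta>"
          by (rule T_less)
        finally have "(\<Sum>K\<in>snd ` p1. Sup K - Inf K) < \<delta>" .
        moreover have "\<Union>(snd ` p1) \<subseteq> {a..b}"
          using interval \<open>p1 \<subseteq> p\<close> by fastforce
        ultimately have less: "(\<Sum>K\<in>snd ` p1. cmod (f (Sup K) - f (Inf K))) < e / 2"
          using \<delta>[rule_format, of "snd ` p1"] div by blast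
        have "norm (\<Sum>(x, K)\<in>p1. measure lborel K *\<^sub>R h x - (f (Sup K) - f (Inf K)))
            \<le> (\<Sum>(x, K)\<in>p1. cmod (f (Sup K) - f (Inf K)))"
          by (rule sum_norm_le) (auto simp: p1_def h_def norm_minus_commute)
        \<comment> \<open>Passing from tags to their intervals requires a summand that vanishes on
          every \<open>cbox u v\<close> with empty interior. This includes the empty set, whose
          \<open>Sup\<close> and \<open>Inf\<close> are not controlled; hence the guard.\<close>
        also have "\<dots> = (\<Sum>(x, K)\<in>p1. if K = {} then 0 else cmod (f (Sup K) - f (Inf K)))"
          by (intro sum.cong) (auto dest!: interval subsetD[OF \<open>p1 \<subseteq> p\<close>])
        also have "\<dots> = (\<Sum>K\<in>snd ` p1. if K = {} then 0 else cmod (f (Sup K) - f (Inf K)))"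
        proof (rule sum.over_tagged_division_lemma[OF tag])
          fix u v :: real
          show "(if cbox u v = {} then 0 else cmod (f (Sup (cbox u v)) - f (Inf (cbox u v)))) = 0"
            if "box u v = {}"
            using that by (cases "u = v") (auto simp: box_eq_empty)
        qed
        also have "\<dots> \<le> (\<Sum>K\<in>snd ` p1. cmod (f (Sup K) - f (Inf K)))"
          by (rule sum_mono) auto
        finally show ?thesis
          using less by linarith
      qed
      moreover have "norm (\<Sum>(x, K)\<in>p - p1. measure lborel K *\<^sub>R h x - (f (Sup K) - f (Inf K))) \<le> e / 2"
      proof -
        have "norm (\<Sum>(x, K)\<in>p - p1. measure lborel K *\<^sub>R h x - (f (Sup K) - f (Inf K)))
            \<le> (\<Sum>(x, K)\<in>p - p1. \<eta> * (Sup K - Inf K))"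
        proof (rule sum_norm_le, clarify)
          fix x K
          assume "(x, K) \<in> p" "(x, K) \<notin> p1"
          then have "x \<notin> E"
            by (auto simp: p1_def)
          obtain u v where K: "K = {u..v}" "u \<le> v" "x \<in> K" "K \<subseteq> {a..b}"
            using interval[OF \<open>(x, K) \<in> p\<close>] by blast
          have "K \<subseteq> ball x (d x)"
            using fineD[OF \<open>\<gamma> fine p\<close> \<open>(x, K) \<in> p\<close>] \<open>x \<notin> E\<close> by (simp add: \<gamma>_def)
          have "u \<in> K" "v \<in> K"
            using K by auto
          \<comment> \<open>Since the tag \<open>x\<close> lies between \<open>u\<close> and
            \<open>v\<close>, the distances from \<open>x\<close> to both ends add up to
            \<open>v - u\<close>, and so do the two errors of linear approximation up to the factor
            \<eta>.\<close>
          have near: "norm (f y - f x - (y - x) *\<^sub>R g x) \<le> \<eta> * norm (y - x)" if "y \<in> K" for y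
            using that K \<open>K \<subseteq> ball x (d x)\<close> \<open>x \<notin> E\<close>
            by (intro d(2)) (auto simp: dist_norm norm_minus_commute)
          have "norm ((v - u) *\<^sub>R g x - (f v - f u))
              = norm (f u - f x - (u - x) *\<^sub>R g x - (f v - f x - (v - x) *\<^sub>R g x))"
            by (auto simp: algebra_simps)
          also have "\<dots> \<le> \<eta> * norm (u - x) + \<eta> * norm (v - x)"
            using norm_triangle_ineq4 near[OF \<open>u \<in> K\<close>] near[OF \<open>v \<in> K\<close>]
            by (metis (no_types, lifting) add_mono order_trans)
          also have "\<dots> = \<eta> * (v - u)"
            using K by (auto simp: algebra_simps)
          finally show "norm (measure lborel K *\<^sub>R h x - (f (Sup K) - f (Inf K))) \<le> \<eta> * (Sup K - Inf K)"
            using K \<open>x \<notin> E\<close> by (simp add: h_def)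
        qed
        also have "\<dots> \<le> (\<Sum>(x, K)\<in>p. \<eta> * (Sup K - Inf K))"
        proof (rule sum_mono2[OF \<open>finite p\<close>])
          show "0 \<le> (case z of (x, K) \<Rightarrow> \<eta> * (Sup K - Inf K))" if "z \<in> p - (p - p1)" for z
            using that interval[of "fst z" "snd z"] \<open>\<eta> > 0\<close> by (cases z) (auto simp: p1_def)
        qed auto
        also have "\<dots> = \<eta> * (b - a)"
          unfolding ba(1) by (simp add: split_def sum_distrib_left)
        finally show ?thesis
          using \<eta>_le by linarith
      qed
      ultimately show ?thesis
        by linarith
    qed
    ultimately show "\<exists>\<gamma>. gauge \<gamma> \<and> (\<forall>p. p tagged_division_of {a..b} \<and> \<gamma> fine p \<longrightarrow>
        norm ((\<Sum>(x, K)\<in>p. measure lborel K *\<^sub>R h x) - (f b - f a)) < e)"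
      by (intro exI[of _ \<gamma>] conjI allI impI)
  qed
  then show ?thesis
    by (rule has_integral_spike[OF E, rotated]) (simp add: h_def)
qed

subsection \<open>Integrals over intervals\<close>

lemma AE_lebesgue_on_subset:
  fixes S T :: "real set"
  assumes "AE x in lebesgue_on T. P x" and "S \<subseteq> T" "S \<in> sets lebesgue" "T \<in> sets lebesgue"
  shows "AE x in lebesgue_on S. P x"
  using assms by (auto simp: AE_restrict_space_iff)

lemma measurable_lebesgue_on_subset:
  fixes f :: "real \<Rightarrow> complex"
  assumes "f \<in> borel_measurable (lebesgue_on {a..b})" and "{c..d} \<subseteq> {a..b}"
  shows "f \<in> borel_measurable (lebesgue_on {c..d})"
  using measurable_restrict_mono[OF assms] .

lemma integral_lebesgue_on_combine:
  fixes f :: "real \<Rightarrow> 'a::euclidean_space"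
  assumes "integrable (lebesgue_on {a..c}) f" and "a \<le> b" "b \<le> c"
  shows "(LINT t|lebesgue_on {a..c}. f t) = (LINT t|lebesgue_on {a..b}. f t) + (LINT t|lebesgue_on {b..c}. f t)"
proof -
  have "integrable (lebesgue_on {a..b}) f" "integrable (lebesgue_on {b..c}) f"
    using assms by (auto intro!: Equivalence_Lebesgue_Henstock_Integration.integrable_subinterval[OF assms(1)])
  then show ?thesis
    using Henstock_Kurzweil_Integration.integral_combine[OF assms(2,3) integrable_on_lebesgue_on[OF assms(1)]] assms(1)
    by (simp add: lebesgue_integral_eq_integral)
qed

text \<open>Additivity of the integral, by induction on the number of pieces. Monotonicity is not
  strict because the first and the last piece degenerate to a point when a sample point is 0 or
  1.\<close>

lemma integral_lebesgue_on_partition: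
  fixes f :: "real \<Rightarrow> 'a::euclidean_space" and y :: "nat \<Rightarrow> real"
  assumes "integrable (lebesgue_on {y 0..y m}) f" and "mono_on {..m} y"
  shows "(LINT t|lebesgue_on {y 0..y m}. f t) = (\<Sum>j<m. LINT t|lebesgue_on {y j..y (Suc j)}. f t)"
  using assms
proof (induction m)
  case 0
  then show ?case
    by (simp add: integral_eq_zero_null_sets)
next
  case (Suc m)
  have "y 0 \<le> y m" "y m \<le> y (Suc m)"
    using Suc.prems(2) by (auto intro: mono_onD)
  moreover have "integrable (lebesgue_on {y 0..y m}) f"
    using \<open>y m \<le> y (Suc m)\<close>
    by (intro Equivalence_Lebesgue_Henstock_Integration.integrable_subinterval[OF Suc.prems(1)]) auto
  moreover have "mono_on {..m} y"
    using Suc.prems(2) by (rule mono_on_subset) auto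
  ultimately show ?case
    using Suc.IH integral_lebesgue_on_combine[OF Suc.prems(1)] by simp
qed

text \<open>Integrability follows from \<open>a * b \<le> a\<^sup>2 + b\<^sup>2\<close>. The
  inequality is Cauchy-Schwarz for nonnegative extended integrals, carried over to the reals because
  all integrals involved are finite.\<close>

lemma
  fixes f g :: "'a \<Rightarrow> complex"
  assumes [measurable]: "f \<in> borel_measurable M" "g \<in> borel_measurable M"
    and f: "integrable M (\<lambda>x. (cmod (f x))\<^sup>2)" and g: "integrable M (\<lambda>x. (cmod (g x))\<^sup>2)"
  shows integrable_mult_L2: "integrable M (\<lambda>x. f x * g x)"
    and cmod_integral_mult_le: "cmod (LINT x|M. f x * g x)
      \<le> sqrt (LINT x|M. (cmod (f x))\<^sup>2) * sqrt (LINT x|M. (cmod (g x))\<^sup>2)"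
proof -
  have ab: "a * b \<le> a\<^sup>2 + b\<^sup>2" for a b :: real
    using sum_squares_bound[of a b] zero_le_power2[of a] zero_le_power2[of b] by linarith
  show fg: "integrable M (\<lambda>x. f x * g x)"
  proof (rule Bochner_Integration.integrable_bound)
    show "integrable M (\<lambda>x. (cmod (f x))\<^sup>2 + (cmod (g x))\<^sup>2)"
      using f g by simp
  qed (auto simp: norm_mult ab)
  then have fg': "integrable M (\<lambda>x. cmod (f x) * cmod (g x))"
    using integrable_norm[OF fg] by (simp add: norm_mult)
  have "ennreal ((LINT x|M. cmod (f x) * cmod (g x))\<^sup>2) = (\<integral>\<^sup>+x. ennreal (cmod (f x)) * ennreal (cmod (g x)) \<partial>M)\<^sup>2"
    using nn_integral_eq_integral[OF fg'] by (simp add: ennreal_mult' ennreal_power)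
  also have "\<dots> \<le> (\<integral>\<^sup>+x. ennreal (cmod (f x)) ^ 2 \<partial>M) * (\<integral>\<^sup>+x. ennreal (cmod (g x)) ^ 2 \<partial>M)"
    by (rule Cauchy_Schwarz_nn_integral) auto
  also have "\<dots> = ennreal ((LINT x|M. (cmod (f x))\<^sup>2) * (LINT x|M. (cmod (g x))\<^sup>2))"
    using nn_integral_eq_integral[OF f] nn_integral_eq_integral[OF g]
    by (simp add: ennreal_power ennreal_mult)
  finally have "(LINT x|M. cmod (f x) * cmod (g x))\<^sup>2 \<le> (LINT x|M. (cmod (f x))\<^sup>2) * (LINT x|M. (cmod (g x))\<^sup>2)"
    by (subst (asm) ennreal_le_iff) auto
  then have "(LINT x|M. cmod (f x) * cmod (g x)) \<le> sqrt (LINT x|M. (cmod (f x))\<^sup>2) * sqrt (LINT x|M. (cmod (g x))\<^sup>2)"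
    by (simp add: real_le_rsqrt real_sqrt_mult[symmetric])
  then show "cmod (LINT x|M. f x * g x)
      \<le> sqrt (LINT x|M. (cmod (f x))\<^sup>2) * sqrt (LINT x|M. (cmod (g x))\<^sup>2)"
    using integral_norm_bound[of M "\<lambda>x. f x * g x"] by (simp add: norm_mult)
qed

lemma finite_measure_lebesgue_on_Icc: "finite_measure (lebesgue_on {a..b::real})"
  by (rule finite_measure_lebesgue_on) simp

section \<open>Square integrable functions on compact intervals\<close>

lemma in_L2_imp_integrable:
  assumes "in_L2 a b g"
  shows "integrable (lebesgue_on {a..b}) g"
proof -
  interpret finite_measure "lebesgue_on {a..b}"
    by (rule finite_measure_lebesgue_on_Icc)
  have "integrable (lebesgue_on {a..b}) (\<lambda>x. g x * 1)"
    using assms by (intro integrable_mult_L2) (auto simp: in_L2_def)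
  then show ?thesis
    by simp
qed

lemma in_L2_continuous:
  assumes "continuous_on {a..b} g"
  shows "in_L2 a b g"
  unfolding in_L2_def
proof
  show "g \<in> borel_measurable (lebesgue_on {a..b})"
    using assms by (simp add: continuous_imp_measurable_on_sets_lebesgue)
  show "integrable (lebesgue_on {a..b}) (\<lambda>t. (cmod (g t))\<^sup>2)"
    using assms by (intro continuous_imp_integrable_real continuous_intros)
qed

lemma in_L2_subset:
  assumes "in_L2 a b g" and "{c..d} \<subseteq> {a..b}"
  shows "in_L2 c d g"
  using assms measurable_lebesgue_on_subset
    Equivalence_Lebesgue_Henstock_Integration.integrable_subinterval
  unfolding in_L2_def by blast

text \<open>Both sides are iterated integrals of \<open>g s * \<rho> t\<close> over the triangle
  \<open>s \<le> t\<close>. This takes the place of integration by parts.\<close>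

lemma integral_primitive_mult:
  fixes g \<rho> :: "real \<Rightarrow> complex"
  assumes g: "integrable (lebesgue_on {a..b}) g" and \<rho>: "integrable (lebesgue_on {a..b}) \<rho>"
  shows "(LINT t|lebesgue_on {a..b}. (LINT s|lebesgue_on {a..t}. g s) * \<rho> t)
      = (LINT s|lebesgue_on {a..b}. g s * (LINT t|lebesgue_on {s..b}. \<rho> t))"
proof -
  define M where "M = lebesgue_on {a..b}"
  interpret finite_measure M
    unfolding M_def by (rule finite_measure_lebesgue_on_Icc)
  interpret pair_sigma_finite M M
    by unfold_locales
  \<comment> \<open>Measurability of the identity is what makes the triangle
    \<open>s \<le> t\<close> measurable in the product space.\<close>
  have [measurable]: "(\<lambda>x. x) \<in> borel_measurable M"
    using id_borel_measurable_lebesgue_on[of "{a..b}"] by (simp add: M_def id_def)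
  have [measurable]: "g \<in> borel_measurable M" "\<rho> \<in> borel_measurable M"
    and g': "integrable M g" and \<rho>': "integrable M \<rho>"
    using g \<rho> by (auto simp: M_def)
  have "integrable (M \<Otimes>\<^sub>M M) (\<lambda>(s, t). g s * \<rho> t)"
    by (rule Fubini_integrable) (auto simp: norm_mult intro: g' \<rho>')
  then have "integrable (M \<Otimes>\<^sub>M M) (\<lambda>(s, t). if s \<le> t then g s * \<rho> t else 0)"
    by (rule Bochner_Integration.integrable_bound) auto
  note fubini = Fubini_integral[OF this]
  have left: "(LINT s|M. (if s \<le> t then g s * \<rho> t else 0)) = (LINT s|lebesgue_on {a..t}. g s) * \<rho> t"
    if "t \<in> {a..b}" for t
  proof -
    have "(LINT s|M. (if s \<le> t then g s * \<rho> t else 0)) = (LINT s|M. (if s \<in> {a..t} then g s * \<rho> t else 0))"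
      by (rule Bochner_Integration.integral_cong) (auto simp: M_def)
    also have "\<dots> = (LINT s|lebesgue_on {a..t}. g s * \<rho> t)"
      unfolding M_def using that by (intro integral_restrict) auto
    finally show ?thesis
      by simp
  qed
  have right: "(LINT t|M. (if s \<le> t then g s * \<rho> t else 0)) = g s * (LINT t|lebesgue_on {s..b}. \<rho> t)"
    if "s \<in> {a..b}" for s
  proof -
    have "(LINT t|M. (if s \<le> t then g s * \<rho> t else 0)) = (LINT t|M. (if t \<in> {s..b} then g s * \<rho> t else 0))"
      by (rule Bochner_Integration.integral_cong) (auto simp: M_def)
    also have "\<dots> = (LINT t|lebesgue_on {s..b}. g s * \<rho> t)"
      unfolding M_def using that by (intro integral_restrict) auto
    finally show ?thesis
      by simp
  qed
  have "(LINT t|M. (LINT s|lebesgue_on {a..t}. g s) * \<rho> t) = (LINT t|M. LINT s|M. (if s \<le> t then g s * \<rho> t else 0))"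
    by (rule Bochner_Integration.integral_cong) (simp_all add: M_def left[unfolded M_def])
  also have "\<dots> = (LINT s|M. LINT t|M. (if s \<le> t then g s * \<rho> t else 0))"
    by (rule fubini)
  also have "\<dots> = (LINT s|M. g s * (LINT t|lebesgue_on {s..b}. \<rho> t))"
    by (rule Bochner_Integration.integral_cong) (simp_all add: M_def right[unfolded M_def])
  finally show ?thesis
    by (simp add: M_def)
qed

subsection \<open>Absolute continuity and the space H10\<close>

lemma abs_continuous_subset:
  assumes "abs_continuous a b f" and "{c..d} \<subseteq> {a..b}"
  shows "abs_continuous c d f"
  unfolding abs_continuous_def
proof (intro allI impI)
  fix \<epsilon> :: real
  assume "\<epsilon> > 0"
  from assms(1)[unfolded abs_continuous_def, rule_format, OF this]
  obtain \<delta> where "\<delta> > 0" and \<delta>: "\<forall>D. D division_of \<Union>D \<and> \<Union>D \<subseteq> {a..b} \<and> (\<Sum>K\<in>D. Sup K - Inf K) < \<delta> \<longrightarrow>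
      (\<Sum>K\<in>D. cmod (f (Sup K) - f (Inf K))) < \<epsilon>"
    by (elim exE conjE)
  show "\<exists>\<delta>>0. \<forall>D. D division_of \<Union>D \<and> \<Union>D \<subseteq> {c..d} \<and> (\<Sum>K\<in>D. Sup K - Inf K) < \<delta> \<longrightarrow>
      (\<Sum>K\<in>D. cmod (f (Sup K) - f (Inf K))) < \<epsilon>"
  proof (intro exI[of _ \<delta>] conjI allI impI)
    fix D assume "D division_of \<Union>D \<and> \<Union>D \<subseteq> {c..d} \<and> (\<Sum>K\<in>D. Sup K - Inf K) < \<delta>"
    then show "(\<Sum>K\<in>D. cmod (f (Sup K) - f (Inf K))) < \<epsilon>"
      using \<delta>[rule_format, of D] subset_trans[OF _ assms(2)] by simp
  qed fact
qed

text \<open>The worst case functions have bounded derivatives, so this is how they are seen to be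
  absolutely continuous.\<close>

lemma lipschitz_on_imp_abs_continuous:
  assumes "L-lipschitz_on {a..b} f"
  shows "abs_continuous a b f"
  unfolding abs_continuous_def
proof (intro allI impI)
  fix \<epsilon> :: real
  assume "\<epsilon> > 0"
  have "L \<ge> 0"
    using assms by (rule lipschitz_on_nonneg)
  show "\<exists>\<delta>>0. \<forall>D. D division_of \<Union>D \<and> \<Union>D \<subseteq> {a..b} \<and> (\<Sum>K\<in>D. Sup K - Inf K) < \<delta> \<longrightarrow>
      (\<Sum>K\<in>D. cmod (f (Sup K) - f (Inf K))) < \<epsilon>"
  \<comment> \<open>\<open>L + 1\<close> instead of \<open>L\<close> avoids a zero denominator for
    constant functions.\<close>
  proof (intro exI[of _ "\<epsilon> / (L + 1)"] conjI allI impI)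
    show "\<epsilon> / (L + 1) > 0"
      using \<open>\<epsilon> > 0\<close> \<open>L \<ge> 0\<close> by simp
    fix D assume D: "D division_of \<Union>D \<and> \<Union>D \<subseteq> {a..b} \<and> (\<Sum>K\<in>D. Sup K - Inf K) < \<epsilon> / (L + 1)"
    have K: "cmod (f (Sup K) - f (Inf K)) \<le> L * (Sup K - Inf K) \<and> 0 \<le> Sup K - Inf K" if "K \<in> D" for K
    proof -
      have "K \<noteq> {}" "K \<subseteq> {a..b}" "\<exists>u v. K = cbox u v"
        using division_ofD(2-4)[of D "\<Union>D" K] D that by (simp_all add: subset_trans[of K "\<Union>D"])
      then obtain u v where "K = {u..v}" "u \<le> v" "u \<in> {a..b}" "v \<in> {a..b}"
        by auto
      then show ?thesis
        using lipschitz_onD[OF assms, of v u] by (simp add: dist_norm)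
    qed
    have "(\<Sum>K\<in>D. cmod (f (Sup K) - f (Inf K))) \<le> L * (\<Sum>K\<in>D. Sup K - Inf K)"
      using K by (simp add: sum_distrib_left sum_mono)
    also have "\<dots> \<le> (L + 1) * (\<Sum>K\<in>D. Sup K - Inf K)"
      using K by (intro mult_right_mono sum_nonneg) auto
    also have "\<dots> < \<epsilon>"
      using D \<open>L \<ge> 0\<close> by (simp add: field_simps)
    finally show "(\<Sum>K\<in>D. cmod (f (Sup K) - f (Inf K))) < \<epsilon>" .
  qed
qed

section \<open>Finite exceptional sets\<close>

lemma AE_lebesgue_on_Icc_finite:
  assumes "finite S" and "\<And>t. t \<in> {a<..<b::real} - S \<Longrightarrow> P t"
  shows "AE t in lebesgue_on {a..b}. P t"
proof -
  have "negligible (S \<union> {a, b})"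
    using assms(1) by (simp add: negligible_finite)
  then have "AE t in lebesgue. t \<in> {a..b} \<longrightarrow> P t"
    unfolding eventually_ae_filter_negligible
    using assms(2) by (intro exI[of _ "S \<union> {a, b}"]) fastforce
  then show ?thesis
    by (simp add: AE_restrict_space_iff)
qed

text \<open>This serves to replace \<open>ae_deriv\<close>, which is not controlled at endpoints and
  partition points, by an explicit function. Measurability carries over because singletons are
  measurable.\<close>

lemma
  assumes g: "in_L2 a b g" and "finite S" and eq: "\<And>t. t \<in> {a<..<b} - S \<Longrightarrow> h t = g t"
  shows in_L2_cong_finite: "in_L2 a b h"
    and L2_norm_cong_finite: "L2_norm a b h = L2_norm a b g"
proof -
  have AE: "AE t in lebesgue_on {a..b}. h t = g t"
    by (rule AE_lebesgue_on_Icc_finite[OF \<open>finite S\<close> eq])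
  have meas: "h \<in> borel_measurable (lebesgue_on {a..b})"
  proof (rule measurable_discrete_difference)
    show "g \<in> borel_measurable (lebesgue_on {a..b})"
      using g by (simp add: in_L2_def)
    show "countable ((S \<union> {a, b}) \<inter> {a..b})"
      using \<open>finite S\<close> by (simp add: countable_finite)
    show "{t} \<in> sets (lebesgue_on {a..b})" if "t \<in> (S \<union> {a, b}) \<inter> {a..b}" for t
      using that by (auto simp: sets_restrict_space_iff)
    show "g t = h t" if "t \<in> space (lebesgue_on {a..b})" "t \<notin> (S \<union> {a, b}) \<inter> {a..b}" for t
      using that eq[of t] by force
  qed auto
  have "integrable (lebesgue_on {a..b}) (\<lambda>t. (cmod (h t))\<^sup>2) \<longleftrightarrow> integrable (lebesgue_on {a..b}) (\<lambda>t. (cmod (g t))\<^sup>2)"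
    using g meas AE by (intro integrable_cong_AE) (auto simp: in_L2_def)
  then show "in_L2 a b h"
    using g meas by (simp add: in_L2_def)
  have "(LINT t|lebesgue_on {a..b}. (cmod (h t))\<^sup>2) = (LINT t|lebesgue_on {a..b}. (cmod (g t))\<^sup>2)"
    using g meas AE by (intro integral_cong_AE) (auto simp: in_L2_def)
  then show "L2_norm a b h = L2_norm a b g"
    by (simp add: L2_norm_def)
qed

section \<open>Integral representation of members of \<open>H10\<close> and of the weighted
  integral\<close>

lemma H10_integrable_ae_deriv:
  assumes "f \<in> H10 a b"
  shows "integrable (lebesgue_on {a..b}) (ae_deriv a b f)"
  using assms by (intro in_L2_imp_integrable) (simp add: H10_def)

text \<open>The fundamental theorem yields a gauge integral. The derivative is in
  \<open>L\<^sub>2\<close>, hence Lebesgue integrable, so both integrals agree; the boundary term at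
  \<open>a\<close> is 0.\<close>

lemma H10_eq_integral:
  assumes f: "f \<in> H10 a b" and t: "t \<in> {a..b}"
  shows "f t = (LINT s|lebesgue_on {a..t}. ae_deriv a b f s)"
proof -
  have sub: "{a..t} \<subseteq> {a..b}"
    using t by auto
  have "AE s in lebesgue. s \<in> {a..b} \<longrightarrow> f differentiable (at s within {a..b})"
    using f by (simp add: H10_def AE_restrict_space_iff)
  then obtain E where E: "negligible E" "\<And>s. s \<in> {a..b} - E \<Longrightarrow> f differentiable (at s within {a..b})"
    unfolding eventually_ae_filter_negligible by blast
  have "(ae_deriv a b f has_integral (f t - f a)) {a..t}"
  proof (rule abs_continuous_imp_has_integral[OF _ _ E(1)])
    show "abs_continuous a t f"
      using f sub by (auto simp: H10_def intro: abs_continuous_subset)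
    show "a \<le> t"
      using t by simp
    show "(f has_vector_derivative ae_deriv a b f s) (at s within {a..t})" if "s \<in> {a..t} - E" for s
      using E(2)[of s] that t has_vector_derivative_within_subset[OF _ sub]
      by (auto simp: ae_deriv_def vector_derivative_works)
  qed
  moreover have "integrable (lebesgue_on {a..t}) (ae_deriv a b f)"
    using Equivalence_Lebesgue_Henstock_Integration.integrable_subinterval[OF H10_integrable_ae_deriv[OF f] sub] .
  ultimately show ?thesis
    using f by (simp add: H10_def lebesgue_integral_eq_integral integral_unique)
qed

lemma continuous_on_primitive:
  assumes "integrable (lebesgue_on {a..b}) \<rho>"
  shows "continuous_on {a..b} (primitive a \<rho>)"
  using indefinite_integral_continuous_real[OF assms] by (simp add: primitive_def[abs_def])

text \<open>After Fubini the derivative is paired with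
  \<open>primitive a \<rho> b - primitive a \<rho> s\<close>. A constant factor contributes nothing
  because the derivative has integral \<open>f b = 0\<close>, which is why \<open>k\<close> is
  free.\<close>

lemma weighted_integral_eq:
  assumes f: "f \<in> H10 a b" and \<rho>: "integrable (lebesgue_on {a..b}) \<rho>" and "a \<le> b"
  shows "integrable (lebesgue_on {a..b}) (\<lambda>s. ae_deriv a b f s * (primitive a \<rho> s - k))" (is ?int)
    and "weighted_integral a b \<rho> f = - (LINT s|lebesgue_on {a..b}. ae_deriv a b f s * (primitive a \<rho> s - k))"
proof -
  have "in_L2 a b (\<lambda>s. primitive a \<rho> s - k)"
    by (intro in_L2_continuous continuous_intros continuous_on_primitive \<rho>)
  then show int: ?int
    using f by (intro integrable_mult_L2) (auto simp: in_L2_def H10_def)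
  have f': "integrable (lebesgue_on {a..b}) (ae_deriv a b f)"
    by (rule H10_integrable_ae_deriv[OF f])
  have zero: "(LINT s|lebesgue_on {a..b}. ae_deriv a b f s) = 0"
    using H10_eq_integral[OF f, of b] f \<open>a \<le> b\<close> by (simp add: H10_def)
  have "weighted_integral a b \<rho> f
      = (LINT t|lebesgue_on {a..b}. (LINT s|lebesgue_on {a..t}. ae_deriv a b f s) * \<rho> t)"
    unfolding weighted_integral_def
    by (rule Bochner_Integration.integral_cong) (auto simp: H10_eq_integral[OF f])
  also have "\<dots> = (LINT s|lebesgue_on {a..b}. ae_deriv a b f s * (LINT t|lebesgue_on {s..b}. \<rho> t))"
    by (rule integral_primitive_mult[OF f' \<rho>])
  \<comment> \<open>The constant \<open>k\<close> is subtracted from both values of the primitive,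
    so that the first product is the derivative times a constant.\<close>
  also have "\<dots> = (LINT s|lebesgue_on {a..b}.
      ae_deriv a b f s * (primitive a \<rho> b - k) - ae_deriv a b f s * (primitive a \<rho> s - k))"
  proof (rule Bochner_Integration.integral_cong)
    fix s assume "s \<in> space (lebesgue_on {a..b})"
    then have "(LINT t|lebesgue_on {s..b}. \<rho> t) = (primitive a \<rho> b - k) - (primitive a \<rho> s - k)"
      using integral_lebesgue_on_combine[OF \<rho>, of s] by (simp add: primitive_def)
    then show "ae_deriv a b f s * (LINT t|lebesgue_on {s..b}. \<rho> t)
        = ae_deriv a b f s * (primitive a \<rho> b - k) - ae_deriv a b f s * (primitive a \<rho> s - k)"
      by (simp only: right_diff_distrib)
  qed simp
  also have "\<dots> = - (LINT s|lebesgue_on {a..b}. ae_deriv a b f s * (primitive a \<rho> s - k))"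
    using int f' zero by simp
  finally show "weighted_integral a b \<rho> f = - (LINT s|lebesgue_on {a..b}. ae_deriv a b f s * (primitive a \<rho> s - k))" .
qed

text \<open>Cauchy-Schwarz for the preceding representation. With \<open>primitive_mean\<close> as
  \<open>k\<close>, the bound is attained by \<open>local_worst_fun\<close>.\<close>

lemma cmod_weighted_integral_le:
  assumes f: "f \<in> H10 a b" and \<rho>: "integrable (lebesgue_on {a..b}) \<rho>" and "a \<le> b"
  shows "cmod (weighted_integral a b \<rho> f)
    \<le> H10_norm a b f * L2_norm a b (\<lambda>u. primitive a \<rho> u - k)"
proof -
  have "in_L2 a b (\<lambda>s. primitive a \<rho> s - k)"
    by (intro in_L2_continuous continuous_intros continuous_on_primitive \<rho>)
  then show ?thesis
    using f unfolding weighted_integral_eq(2)[OF assms, of k] norm_minus_cancel H10_norm_def L2_norm_def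
    by (intro cmod_integral_mult_le) (auto simp: in_L2_def H10_def)
qed

text \<open>A membership criterion for both the local and the glued worst case functions; in the
  second case \<open>S\<close> consists of the partition points.\<close>

lemma H10I_lipschitz:
  assumes lip: "L-lipschitz_on {a..b} f" and "finite S"
    and deriv: "\<And>t. t \<in> {a<..<b} - S \<Longrightarrow> (f has_vector_derivative g t) (at t)"
    and g: "in_L2 a b g" and "f a = 0" "f b = 0"
  shows "f \<in> H10 a b" and "AE t in lebesgue_on {a..b}. ae_deriv a b f t = g t"
    and "H10_norm a b f = L2_norm a b g"
proof -
  have eq: "ae_deriv a b f t = g t" if "t \<in> {a<..<b} - S" for t
    using deriv[OF that] that by (auto simp: ae_deriv_def intro: vector_derivative_at_within_ivl)
  show "AE t in lebesgue_on {a..b}. ae_deriv a b f t = g t"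
    by (rule AE_lebesgue_on_Icc_finite[OF \<open>finite S\<close> eq])
  have "in_L2 a b (ae_deriv a b f)"
    by (rule in_L2_cong_finite[OF g \<open>finite S\<close> eq])
  moreover have "AE t in lebesgue_on {a..b}. f differentiable (at t within {a..b})"
    by (rule AE_lebesgue_on_Icc_finite[OF \<open>finite S\<close>],
        rule differentiableI_vector, rule has_vector_derivative_at_within, rule deriv)
  ultimately show "f \<in> H10 a b"
    using lipschitz_on_imp_abs_continuous[OF lip] assms(5,6) by (simp add: H10_def)
  show "H10_norm a b f = L2_norm a b g"
    unfolding H10_norm_def by (rule L2_norm_cong_finite[OF g \<open>finite S\<close> eq])
qed

subsection \<open>The local worst case function\<close>

text \<open>The integrand of \<open>local_worst_fun\<close> with the outer minus sign moved inside.
  It is a real multiple of the conjugate of the centered primitive, the equality case of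
  Cauchy-Schwarz.\<close>

definition worst_deriv :: "real \<Rightarrow> real \<Rightarrow> (real \<Rightarrow> complex) \<Rightarrow> real \<Rightarrow> complex" where
  "worst_deriv a b \<rho> s = - ((cnj (primitive a \<rho> s) - cnj (primitive_mean a b \<rho>)) /
     complex_of_real (L2_norm a b (\<lambda>u. primitive a \<rho> u - primitive_mean a b \<rho>)))"

lemma local_worst_fun_eq: "local_worst_fun a b \<rho> t = (LINT s|lebesgue_on {a..t}. worst_deriv a b \<rho> s)"
  by (simp add: local_worst_fun_def worst_deriv_def)

lemma L2_norm_nonneg [simp]: "L2_norm a b g \<ge> 0"
  by (simp add: L2_norm_def)

lemma L2_norm_power2: "(L2_norm a b g)\<^sup>2 = (LINT t|lebesgue_on {a..b}. (cmod (g t))\<^sup>2)"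
  by (simp add: L2_norm_def)


text \<open>For continuous integrands the Lebesgue and gauge integrals agree, so the classical
  fundamental theorem applies. A bound of \<open>h\<close> on the compact interval is a Lipschitz
  constant.\<close>

lemma
  fixes h :: "real \<Rightarrow> complex"
  assumes h: "continuous_on {a..b} h"
  shows lipschitz_on_indefinite_integral:
    "\<exists>L. L-lipschitz_on {a..b} (\<lambda>t. LINT s|lebesgue_on {a..t}. h s)"
    and indefinite_integral_has_vector_derivative: "t \<in> {a..b} \<Longrightarrow>
      ((\<lambda>t. LINT s|lebesgue_on {a..t}. h s) has_vector_derivative h t) (at t within {a..b})"
proof -
  have eq: "(LINT s|lebesgue_on {a..t}. h s) = integral {a..t} h" if "t \<in> {a..b}" for t
    using that continuous_on_subset[OF h] by (intro lebesgue_integral_eq_integral continuous_imp_integrable_real) auto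
  show deriv: "((\<lambda>t. LINT s|lebesgue_on {a..t}. h s) has_vector_derivative h t) (at t within {a..b})"
    if "t \<in> {a..b}" for t
    by (rule has_vector_derivative_transform[OF that eq integral_has_vector_derivative[OF h that]])
  have "bounded (h ` {a..b})"
    using h by (intro compact_imp_bounded compact_continuous_image) auto
  then obtain B where "B > 0" and B: "\<And>t. t \<in> {a..b} \<Longrightarrow> norm (h t) \<le> B"
    by (auto simp: bounded_pos)
  have "B-lipschitz_on {a..b} (\<lambda>t. LINT s|lebesgue_on {a..t}. h s)"
  proof (rule bounded_derivative_imp_lipschitz)
    show "((\<lambda>t. LINT s|lebesgue_on {a..t}. h s) has_derivative (\<lambda>u. u *\<^sub>R h t)) (at t within {a..b})"
      if "t \<in> {a..b}" for t
      using deriv[OF that] by (simp add: has_vector_derivative_def)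
    show "onorm (\<lambda>u. u *\<^sub>R h t) \<le> B" if "t \<in> {a..b}" for t
      using B[OF that] by (intro onorm_le) (auto simp: mult.commute[of B] intro: mult_left_mono)
  qed (use \<open>B > 0\<close> in auto)
  then show "\<exists>L. L-lipschitz_on {a..b} (\<lambda>t. LINT s|lebesgue_on {a..t}. h s)"
    by blast
qed

context
  fixes a b :: real and \<rho> :: "real \<Rightarrow> complex"
  assumes ab: "a \<le> b" and \<rho>: "integrable (lebesgue_on {a..b}) \<rho>"
begin

abbreviation (input) "centered \<equiv> (\<lambda>u. primitive a \<rho> u - primitive_mean a b \<rho>)"

lemma continuous_on_centered: "continuous_on {a..b} centered"
  by (intro continuous_intros continuous_on_primitive \<rho>)

lemma continuous_on_worst_deriv: "continuous_on {a..b} (worst_deriv a b \<rho>)"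
  \<comment> \<open>Multiplication by a constant inverse is continuous even if the norm in the
    denominator is 0.\<close>
  unfolding worst_deriv_def[abs_def] divide_inverse
  by (intro continuous_intros continuous_on_primitive \<rho>)

lemma local_worst_fun_lipschitz: "\<exists>L. L-lipschitz_on {a..b} (local_worst_fun a b \<rho>)"
  using lipschitz_on_indefinite_integral[OF continuous_on_worst_deriv]
  by (simp add: local_worst_fun_eq[abs_def])

lemma local_worst_fun_has_vector_derivative:
  assumes "t \<in> {a<..<b}"
  shows "(local_worst_fun a b \<rho> has_vector_derivative worst_deriv a b \<rho> t) (at t)"
  using indefinite_integral_has_vector_derivative[OF continuous_on_worst_deriv, of t] assms
  by (simp add: local_worst_fun_eq[abs_def] at_within_Icc_at)

lemma local_worst_fun_left: "local_worst_fun a b \<rho> a = 0"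
  by (simp add: local_worst_fun_eq integral_eq_zero_null_sets)

text \<open>Subtracting the mean makes the integral over the whole interval vanish. A degenerate
  interval is settled by its left endpoint.\<close>

lemma local_worst_fun_right: "local_worst_fun a b \<rho> b = 0"
proof (cases "a = b")
  case True
  then show ?thesis
    using local_worst_fun_left by simp
next
  case False
  have int: "integrable (lebesgue_on {a..b}) (primitive a \<rho>)"
    by (intro continuous_imp_integrable_real continuous_on_primitive \<rho>)
  interpret finite_measure "lebesgue_on {a..b}"
    by (rule finite_measure_lebesgue_on_Icc)
  have "(LINT s|lebesgue_on {a..b}. centered s) = 0"
    using int False ab
    by (simp add: primitive_mean_def measure_restrict_space scaleR_conv_of_real)
  then have "(LINT s|lebesgue_on {a..b}. cnj (centered s)) = 0"
    unfolding Bochner_Integration.integral_cnj by simp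
  then show ?thesis
    by (simp add: local_worst_fun_def)
qed

lemma local_worst_fun_H10: "local_worst_fun a b \<rho> \<in> H10 a b"
  and ae_deriv_local_worst_fun:
    "AE t in lebesgue_on {a..b}. ae_deriv a b (local_worst_fun a b \<rho>) t = worst_deriv a b \<rho> t"
  and H10_norm_local_worst_fun:
    "H10_norm a b (local_worst_fun a b \<rho>) = L2_norm a b (worst_deriv a b \<rho>)"
proof -
  obtain L where "L-lipschitz_on {a..b} (local_worst_fun a b \<rho>)"
    using local_worst_fun_lipschitz by blast
  note * = H10I_lipschitz[OF this finite.emptyI local_worst_fun_has_vector_derivative
      in_L2_continuous[OF continuous_on_worst_deriv] local_worst_fun_left local_worst_fun_right]
  show "local_worst_fun a b \<rho> \<in> H10 a b"
    by (rule *(1)) simp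
  show "AE t in lebesgue_on {a..b}. ae_deriv a b (local_worst_fun a b \<rho>) t = worst_deriv a b \<rho> t"
    by (rule *(2)) simp
  show "H10_norm a b (local_worst_fun a b \<rho>) = L2_norm a b (worst_deriv a b \<rho>)"
    by (rule *(3)) simp
qed

lemma L2_norm_worst_deriv:
  "L2_norm a b (worst_deriv a b \<rho>) = (if L2_norm a b centered = 0 then 0 else 1)"
proof -
  have "cmod (worst_deriv a b \<rho> t) = cmod (centered t) / L2_norm a b centered" for t
    by (simp add: worst_deriv_def norm_divide flip: complex_cnj_diff)
  then have "(L2_norm a b (worst_deriv a b \<rho>))\<^sup>2 = (L2_norm a b centered)\<^sup>2 / (L2_norm a b centered)\<^sup>2"
    by (simp add: L2_norm_power2[of a b "worst_deriv a b \<rho>"] L2_norm_power2[of a b centered] power_divide)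
  then show ?thesis
    by (auto simp: power2_eq_1_iff) (metis L2_norm_nonneg neg_0_le_iff_le not_one_le_zero)
qed

text \<open>The derivative times the centered primitive is minus its squared modulus divided by its
  norm \<open>?N\<close>, so Cauchy-Schwarz becomes an equality.\<close>

lemma weighted_integral_local_worst_fun:
  "weighted_integral a b \<rho> (local_worst_fun a b \<rho>) = complex_of_real (L2_norm a b centered)"
proof -
  let ?N = "L2_norm a b centered"
  have "weighted_integral a b \<rho> (local_worst_fun a b \<rho>)
      = - (LINT s|lebesgue_on {a..b}. ae_deriv a b (local_worst_fun a b \<rho>) s * centered s)"
    by (rule weighted_integral_eq(2)[OF local_worst_fun_H10 \<rho> ab])
  also have "(LINT s|lebesgue_on {a..b}. ae_deriv a b (local_worst_fun a b \<rho>) s * centered s)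
      = (LINT s|lebesgue_on {a..b}. - complex_of_real ((cmod (centered s))\<^sup>2 / ?N))"
  proof (rule integral_cong_AE)
    have [measurable]: "centered \<in> borel_measurable (lebesgue_on {a..b})"
      using continuous_on_centered by (simp add: continuous_imp_measurable_on_sets_lebesgue)
    show "(\<lambda>s. - complex_of_real ((cmod (centered s))\<^sup>2 / ?N)) \<in> borel_measurable (lebesgue_on {a..b})"
      by measurable
    show "(\<lambda>s. ae_deriv a b (local_worst_fun a b \<rho>) s * centered s) \<in> borel_measurable (lebesgue_on {a..b})"
      by (rule borel_measurable_integrable[OF weighted_integral_eq(1)[OF local_worst_fun_H10 \<rho> ab]])
    show "AE s in lebesgue_on {a..b}. ae_deriv a b (local_worst_fun a b \<rho>) s * centered s
        = - complex_of_real ((cmod (centered s))\<^sup>2 / ?N)"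
      using ae_deriv_local_worst_fun
    proof eventually_elim
      case (elim s)
      have "(cnj (primitive a \<rho> s) - cnj (primitive_mean a b \<rho>)) * centered s = complex_of_real ((cmod (centered s))\<^sup>2)"
        unfolding complex_norm_square complex_cnj_diff by (rule mult.commute)
      then show ?case
        by (simp add: elim worst_deriv_def)
    qed
  qed
  also have "\<dots> = - complex_of_real (LINT s|lebesgue_on {a..b}. (cmod (centered s))\<^sup>2 / ?N)"
    by (simp only: integral_minus integral_complex_of_real)
  \<comment> \<open>The quotient of the squared norm by the norm equals \<open>?N\<close> also for
    \<open>?N = 0\<close>, by the convention on division by zero.\<close>
  also have "(LINT s|lebesgue_on {a..b}. (cmod (centered s))\<^sup>2 / ?N) = ?N"
    by (simp add: L2_norm_power2[symmetric]) (simp add: power2_eq_square)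
  finally show ?thesis
    by simp
qed

text \<open>The supremum is a maximum: Cauchy-Schwarz bounds it and \<open>local_worst_fun\<close>
  attains it. The norm of that function is 1 or, in the degenerate case, 0, and both are
  admissible.\<close>

lemma initial_error_eq: "initial_error a b \<rho> = L2_norm a b centered"
  unfolding initial_error_def
proof (rule cSup_eq_maximum)
  have "H10_norm a b (local_worst_fun a b \<rho>) \<le> 1"
    unfolding H10_norm_local_worst_fun L2_norm_worst_deriv by simp
  then show "L2_norm a b centered
      \<in> {cmod (weighted_integral a b \<rho> f) |f. f \<in> H10 a b \<and> H10_norm a b f \<le> 1}"
    using local_worst_fun_H10 weighted_integral_local_worst_fun by force
  fix r assume "r \<in> {cmod (weighted_integral a b \<rho> f) |f. f \<in> H10 a b \<and> H10_norm a b f \<le> 1}"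
  then obtain f where f: "f \<in> H10 a b" "H10_norm a b f \<le> 1" "r = cmod (weighted_integral a b \<rho> f)"
    by blast
  have "r \<le> H10_norm a b f * L2_norm a b centered"
    unfolding f(3) by (rule cmod_weighted_integral_le[OF f(1) \<rho> ab])
  also have "\<dots> \<le> 1 * L2_norm a b centered"
    using f(2) by (intro mult_right_mono) simp_all
  finally show "r \<le> L2_norm a b centered"
    by simp
qed

end

subsection \<open>Restriction to a partition\<close>

lemma in_L2_add:
  assumes "in_L2 a b f" "in_L2 a b g"
  shows "in_L2 a b (\<lambda>t. f t + g t)"
proof -
  have [measurable]: "f \<in> borel_measurable (lebesgue_on {a..b})" "g \<in> borel_measurable (lebesgue_on {a..b})"
    using assms by (auto simp: in_L2_def)
  have "integrable (lebesgue_on {a..b}) (\<lambda>t. (cmod (f t + g t))\<^sup>2)"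
  proof (rule Bochner_Integration.integrable_bound)
    show "integrable (lebesgue_on {a..b}) (\<lambda>t. 2 * (cmod (f t))\<^sup>2 + 2 * (cmod (g t))\<^sup>2)"
      using assms by (simp add: in_L2_def)
    have "(cmod (f t + g t))\<^sup>2 \<le> 2 * (cmod (f t))\<^sup>2 + 2 * (cmod (g t))\<^sup>2" for t
    proof -
      have "(cmod (f t + g t))\<^sup>2 \<le> (cmod (f t) + cmod (g t))\<^sup>2"
        by (intro power_mono norm_triangle_ineq) simp
      also have "\<dots> \<le> 2 * (cmod (f t))\<^sup>2 + 2 * (cmod (g t))\<^sup>2"
        using sum_squares_bound[of "cmod (f t)" "cmod (g t)"] by (simp add: power2_sum)
      finally show ?thesis .
    qed
    then show "AE t in lebesgue_on {a..b}. norm ((cmod (f t + g t))\<^sup>2)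
        \<le> norm (2 * (cmod (f t))\<^sup>2 + 2 * (cmod (g t))\<^sup>2)"
      by simp
  qed measurable
  then show ?thesis
    by (simp add: in_L2_def)
qed

lemma in_L2_sum:
  assumes "\<And>j. j \<in> A \<Longrightarrow> in_L2 a b (f j)"
  shows "in_L2 a b (\<lambda>t. \<Sum>j\<in>A. f j t)"
  using assms
proof (induction A rule: infinite_finite_induct)
  case (insert j A)
  then show ?case
    using in_L2_add[of a b "f j" "\<lambda>t. \<Sum>j\<in>A. f j t"] by simp
qed (simp_all add: in_L2_def)

lemma in_L2_extend_zero:
  assumes h: "in_L2 c d h" and sub: "{c..d} \<subseteq> {a..b}"
  shows "in_L2 a b (\<lambda>t. if t \<in> {c..d} then h t else 0)"
proof -
  have "integrable lebesgue (\<lambda>t. if t \<in> {c..d} then (cmod (h t))\<^sup>2 else 0)"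
    using h Lebesgue_Measure.integrable_restrict_UNIV[of "{c..d}" "\<lambda>t. (cmod (h t))\<^sup>2"] by (simp add: in_L2_def)
  moreover have "(\<lambda>t. if t \<in> {c..d} then (cmod (h t))\<^sup>2 else 0)
      = (\<lambda>t. if t \<in> {a..b} then (cmod (if t \<in> {c..d} then h t else 0))\<^sup>2 else 0)"
    using sub by (intro ext) (auto simp: subset_iff)
  ultimately have "integrable (lebesgue_on {a..b}) (\<lambda>t. (cmod (if t \<in> {c..d} then h t else 0))\<^sup>2)"
    using Lebesgue_Measure.integrable_restrict_UNIV[of "{a..b}" "\<lambda>t. (cmod (if t \<in> {c..d} then h t else 0))\<^sup>2"] by simp
  moreover have "(\<lambda>t. if t \<in> {c..d} then h t else 0) \<in> borel_measurable (lebesgue_on {a..b})"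
    using h borel_measurable_if_lebesgue_on[OF _ _ sub, of h] by (simp add: in_L2_def)
  ultimately show ?thesis
    by (simp add: in_L2_def)
qed

lemma in_L2_cmult:
  assumes "in_L2 a b f"
  shows "in_L2 a b (\<lambda>t. k * f t)"
  using assms by (auto simp: in_L2_def norm_mult power_mult_distrib intro!: borel_measurable_times)

lemma L2_norm_cmult: "L2_norm a b (\<lambda>t. k * f t) = cmod k * L2_norm a b f"
  by (simp add: L2_norm_def norm_mult power_mult_distrib real_sqrt_mult)

lemma lipschitz_on_sum:
  fixes f :: "'i \<Rightarrow> real \<Rightarrow> complex"
  assumes "\<And>j. j \<in> A \<Longrightarrow> \<exists>L. L-lipschitz_on U (f j)"
  shows "\<exists>L. L-lipschitz_on U (\<lambda>t. \<Sum>j\<in>A. f j t)"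
  using assms
proof (induction A rule: infinite_finite_induct)
  case (insert j A)
  obtain K where "K-lipschitz_on U (f j)"
    using insert.prems by blast
  moreover obtain L where "L-lipschitz_on U (\<lambda>t. \<Sum>j\<in>A. f j t)"
    using insert.IH insert.prems by blast
  ultimately have "(K + L)-lipschitz_on U (\<lambda>t. f j t + (\<Sum>j\<in>A. f j t))"
    by (rule lipschitz_on_add)
  then show ?case
    using insert.hyps by auto
qed (auto intro: lipschitz_on_constant)

lemma ae_deriv_subinterval:
  assumes "{c..d} \<subseteq> {a..b}" and "t \<in> {c<..<d}"
  shows "ae_deriv c d f t = ae_deriv a b f t"
proof -
  have "t \<in> {a<..<b}"
    using assms by auto
  then show ?thesis
    using assms(2) by (simp add: ae_deriv_def at_within_Icc_at)
qed

text \<open>The derivatives relative to the two intervals can differ only at \<open>c\<close> and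
  \<open>d\<close>. Local norms can therefore be computed from one global derivative, which makes
  their squares additive.\<close>

lemma
  assumes f: "f \<in> H10 a b" and sub: "{c..d} \<subseteq> {a..b}"
  shows H10_norm_subinterval: "H10_norm c d f = L2_norm c d (ae_deriv a b f)"
    and H10_subinterval: "f c = 0 \<Longrightarrow> f d = 0 \<Longrightarrow> f \<in> H10 c d"
proof -
  have L2: "in_L2 c d (ae_deriv a b f)"
    using f sub by (auto simp: H10_def intro: in_L2_subset)
  note eq = ae_deriv_subinterval[OF sub, of _ f]
  show "H10_norm c d f = L2_norm c d (ae_deriv a b f)"
    unfolding H10_norm_def by (rule L2_norm_cong_finite[OF L2 finite.emptyI eq]) simp
  have "in_L2 c d (ae_deriv c d f)"
    by (rule in_L2_cong_finite[OF L2 finite.emptyI eq]) simp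
  moreover have "AE t in lebesgue_on {c..d}. f differentiable (at t within {a..b})"
    using f sub by (intro AE_lebesgue_on_subset[OF _ sub]) (auto simp: H10_def)
  then have "AE t in lebesgue_on {c..d}. f differentiable (at t within {c..d})"
    by (rule eventually_mono) (rule differentiable_within_subset[OF _ sub])
  moreover have "abs_continuous c d f"
    using f sub by (auto simp: H10_def intro: abs_continuous_subset)
  ultimately show "f \<in> H10 c d" if "f c = 0" "f d = 0"
    using that by (simp add: H10_def)
qed

text \<open>As an indefinite integral, \<open>f\<close> is continuous and hence bounded on the
  compact interval, so a multiple of \<rho> dominates the product.\<close>

lemma H10_mult_integrable:
  assumes f: "f \<in> H10 a b" and \<rho>: "integrable (lebesgue_on {a..b}) \<rho>"
  shows "integrable (lebesgue_on {a..b}) (\<lambda>t. f t * \<rho> t)"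
proof -
  have "continuous_on {a..b} (\<lambda>t. LINT s|lebesgue_on {a..t}. ae_deriv a b f s)"
    by (rule indefinite_integral_continuous_real[OF H10_integrable_ae_deriv[OF f]])
  then have cont: "continuous_on {a..b} f"
    by (rule continuous_on_eq) (simp add: H10_eq_integral[OF f])
  then have [measurable]: "f \<in> borel_measurable (lebesgue_on {a..b})"
    by (simp add: continuous_imp_measurable_on_sets_lebesgue)
  have [measurable]: "\<rho> \<in> borel_measurable (lebesgue_on {a..b})"
    using \<rho> by (rule borel_measurable_integrable)
  have "bounded (f ` {a..b})"
    using cont by (intro compact_imp_bounded compact_continuous_image) auto
  then obtain B where "B > 0" and B: "\<And>t. t \<in> {a..b} \<Longrightarrow> cmod (f t) \<le> B"
    by (auto simp: bounded_pos)
  show ?thesis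
  proof (rule Bochner_Integration.integrable_bound)
    show "integrable (lebesgue_on {a..b}) (\<lambda>t. complex_of_real B * \<rho> t)"
      using \<rho> by simp
    show "AE t in lebesgue_on {a..b}. cmod (f t * \<rho> t) \<le> cmod (complex_of_real B * \<rho> t)"
      using B \<open>B > 0\<close> by (intro AE_I2) (simp add: norm_mult mult_right_mono)
  qed measurable
qed

section \<open>Splitting along a partition, and the upper bound\<close>

lemma Icc_mono_on_subset:
  fixes y :: "nat \<Rightarrow> real"
  assumes "mono_on {..m} y" and "j < m"
  shows "{y j..y (Suc j)} \<subseteq> {y 0..y m}" and "y j \<le> y (Suc j)"
proof -
  have "y 0 \<le> y j" "y (Suc j) \<le> y m"
    using assms by (auto intro: mono_onD)
  then show "{y j..y (Suc j)} \<subseteq> {y 0..y m}"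
    by auto
  show "y j \<le> y (Suc j)"
    using assms by (auto intro: mono_onD)
qed

lemma weighted_integral_partition:
  assumes y: "mono_on {..m} y" and f: "f \<in> H10 (y 0) (y m)" and \<rho>: "integrable (lebesgue_on {y 0..y m}) \<rho>"
  shows "weighted_integral (y 0) (y m) \<rho> f = (\<Sum>j<m. weighted_integral (y j) (y (Suc j)) \<rho> f)"
  unfolding weighted_integral_def
  by (rule integral_lebesgue_on_partition[OF H10_mult_integrable[OF f \<rho>] y])

lemma L2_norm_partition:
  assumes y: "mono_on {..m} y" and g: "in_L2 (y 0) (y m) g"
  shows "(L2_norm (y 0) (y m) g)\<^sup>2 = (\<Sum>j<m. (L2_norm (y j) (y (Suc j)) g)\<^sup>2)"
  unfolding L2_norm_power2
  by (rule integral_lebesgue_on_partition[OF _ y]) (use g in \<open>simp add: in_L2_def\<close>)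

text \<open>On each piece \<open>f\<close> belongs to the local space because it vanishes at both
  ends, which gives the local bound. Cauchy-Schwarz for sums combines these bounds, and the squared
  local norms add up to the squared global norm.\<close>

lemma cmod_weighted_integral_le_partition:
  assumes y: "mono_on {..m} y" and f: "f \<in> H10 (y 0) (y m)" and zero: "\<And>j. j \<le> m \<Longrightarrow> f (y j) = 0"
    and \<rho>: "integrable (lebesgue_on {y 0..y m}) \<rho>"
  shows "cmod (weighted_integral (y 0) (y m) \<rho> f)
    \<le> H10_norm (y 0) (y m) f * sqrt (\<Sum>j<m. (initial_error (y j) (y (Suc j)) \<rho>)\<^sup>2)"
proof -
  let ?e = "\<lambda>j. initial_error (y j) (y (Suc j)) \<rho>"
  let ?h = "\<lambda>j. H10_norm (y j) (y (Suc j)) f"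
  have "cmod (weighted_integral (y 0) (y m) \<rho> f) \<le> (\<Sum>j<m. cmod (weighted_integral (y j) (y (Suc j)) \<rho> f))"
    unfolding weighted_integral_partition[OF y f \<rho>] by (rule norm_sum)
  also have "\<dots> \<le> (\<Sum>j<m. ?h j * ?e j)"
  proof (rule sum_mono)
    fix j assume "j \<in> {..<m}"
    then have "j < m"
      by simp
    note sub = Icc_mono_on_subset[OF y this]
    have \<rho>j: "integrable (lebesgue_on {y j..y (Suc j)}) \<rho>"
      by (rule Equivalence_Lebesgue_Henstock_Integration.integrable_subinterval[OF \<rho> sub(1)])
    have "f \<in> H10 (y j) (y (Suc j))"
      using H10_subinterval[OF f sub(1)] zero \<open>j < m\<close> by simp
    then show "cmod (weighted_integral (y j) (y (Suc j)) \<rho> f) \<le> ?h j * ?e j"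
      unfolding initial_error_eq[OF sub(2) \<rho>j] by (rule cmod_weighted_integral_le[OF _ \<rho>j sub(2)])
  qed
  also have "\<dots> \<le> sqrt ((\<Sum>j<m. (?h j)\<^sup>2) * (\<Sum>j<m. (?e j)\<^sup>2))"
    by (rule real_le_rsqrt) (rule Cauchy_Schwarz_ineq_sum)
  also have "(\<Sum>j<m. (?h j)\<^sup>2) = (\<Sum>j<m. (L2_norm (y j) (y (Suc j)) (ae_deriv (y 0) (y m) f))\<^sup>2)"
    by (rule sum.cong) (simp_all add: H10_norm_subinterval[OF f Icc_mono_on_subset(1)[OF y]])
  also have "\<dots> = (H10_norm (y 0) (y m) f)\<^sup>2"
    unfolding H10_norm_def by (rule L2_norm_partition[OF y, symmetric]) (use f in \<open>simp add: H10_def\<close>)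
  finally show ?thesis
    by (simp add: real_sqrt_mult H10_norm_def)
qed

text \<open>Away from the partition points, a whole neighbourhood of \<open>t\<close> lies in one
  piece, as needed for derivatives. The induction compares \<open>t\<close> with
  \<open>y m\<close>.\<close>

lemma mem_partition_interior:
  fixes y :: "nat \<Rightarrow> real"
  assumes "t \<in> {y 0<..<y m} - y ` {..m}"
  shows "\<exists>i<m. t \<in> {y i<..<y (Suc i)}"
  using assms
proof (induction m)
  case (Suc m)
  show ?case
  proof (cases "t < y m")
    case True
    then have "t \<in> {y 0<..<y m} - y ` {..m}"
      using Suc.prems by auto
    then show ?thesis
      using Suc.IH less_SucI by blast
  next
    case False
    moreover have "t \<noteq> y m" "t < y (Suc m)"
      using Suc.prems by auto
    ultimately show ?thesis
      by (intro exI[of _ m]) auto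
  qed
qed simp

subsection \<open>Glueing the local worst case functions\<close>

text \<open>
  The argument of each local function is clamped to its interval. As the local functions vanish
  at the endpoints, only one summand survives on each interval, and no case distinction is needed
  to see that the sum is Lipschitz.
\<close>

definition glued_worst_fun ::
  "(nat \<Rightarrow> real) \<Rightarrow> nat \<Rightarrow> (real \<Rightarrow> complex) \<Rightarrow> (nat \<Rightarrow> complex) \<Rightarrow> real \<Rightarrow> complex" where
  "glued_worst_fun y m \<rho> k t =
     (\<Sum>j<m. k j * local_worst_fun (y j) (y (Suc j)) \<rho> (max (y j) (min t (y (Suc j)))))"

context
  fixes y :: "nat \<Rightarrow> real" and m :: nat and \<rho> :: "real \<Rightarrow> complex" and k :: "nat \<Rightarrow> complex"
  assumes y: "mono_on {..m} y" and \<rho>: "integrable (lebesgue_on {y 0..y m}) \<rho>"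
begin

lemma integrable_piece: "j < m \<Longrightarrow> integrable (lebesgue_on {y j..y (Suc j)}) \<rho>"
  by (rule Equivalence_Lebesgue_Henstock_Integration.integrable_subinterval[OF \<rho> Icc_mono_on_subset(1)[OF y]])

text \<open>Clamping sends \<open>t\<close> to the right endpoint of every earlier piece and to the
  left endpoint of every later one, where the local functions are 0.\<close>

lemma glued_worst_fun_piece:
  assumes "i < m" and t: "t \<in> {y i..y (Suc i)}"
  shows "glued_worst_fun y m \<rho> k t = k i * local_worst_fun (y i) (y (Suc i)) \<rho> t"
proof -
  have "k j * local_worst_fun (y j) (y (Suc j)) \<rho> (max (y j) (min t (y (Suc j))))
      = (if j = i then k i * local_worst_fun (y i) (y (Suc i)) \<rho> t else 0)" if "j < m" for j
  proof -
    note le = Icc_mono_on_subset(2)[OF y that]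
    consider "j = i" | "j < i" | "i < j"
      by linarith
    then show ?thesis
    proof cases
      case 1
      then show ?thesis
        using t by (simp add: min_absorb1 max_absorb2)
    next
      case 2
      then have "y (Suc j) \<le> y i"
        using assms(1) by (intro mono_onD[OF y]) auto
      then have "max (y j) (min t (y (Suc j))) = y (Suc j)"
        using t le by auto
      then show ?thesis
        using 2 local_worst_fun_right[OF le integrable_piece[OF that]] by simp
    next
      case 3
      then have "y (Suc i) \<le> y j"
        using that by (intro mono_onD[OF y]) auto
      then have "max (y j) (min t (y (Suc j))) = y j"
        using t le by auto
      then show ?thesis
        using 3 local_worst_fun_left[OF le integrable_piece[OF that]] by simp
    qed
  qed
  then have "glued_worst_fun y m \<rho> k t
      = (\<Sum>j<m. if j = i then k i * local_worst_fun (y i) (y (Suc i)) \<rho> t else 0)"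
    unfolding glued_worst_fun_def by (intro sum.cong) auto
  then show ?thesis
    using assms(1) by simp
qed

lemma glued_worst_fun_partition_point:
  assumes "0 < m" and "i \<le> m"
  shows "glued_worst_fun y m \<rho> k (y i) = 0"
proof (cases "i < m")
  case True
  then show ?thesis
    using glued_worst_fun_piece[OF True, of "y i"] Icc_mono_on_subset(2)[OF y True]
      local_worst_fun_left[OF _ integrable_piece[OF True]] by simp
next
  case False
  \<comment> \<open>Only \<open>i = m\<close> remains, the right endpoint of the last piece; there
    is one because \<open>0 < m\<close>.\<close>
  then obtain j where j: "i = Suc j" "j < m"
    using assms by (cases i) auto
  then show ?thesis
    using glued_worst_fun_piece[OF j(2), of "y i"] Icc_mono_on_subset(2)[OF y j(2)]
      local_worst_fun_right[OF _ integrable_piece[OF j(2)]] by simp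
qed

text \<open>Clamping does not increase distances, so each summand inherits a Lipschitz constant from
  its local function.\<close>

lemma glued_worst_fun_lipschitz: "\<exists>L. L-lipschitz_on U (glued_worst_fun y m \<rho> k)"
  unfolding glued_worst_fun_def[abs_def]
proof (rule lipschitz_on_sum)
  fix j assume "j \<in> {..<m}"
  then have "j < m"
    by simp
  note le = Icc_mono_on_subset(2)[OF y this]
  obtain L where L: "L-lipschitz_on {y j..y (Suc j)} (local_worst_fun (y j) (y (Suc j)) \<rho>)"
    using local_worst_fun_lipschitz[OF le integrable_piece[OF \<open>j < m\<close>]] by blast
  have "(cmod (k j) * L)-lipschitz_on U
      (\<lambda>t. k j * local_worst_fun (y j) (y (Suc j)) \<rho> (max (y j) (min t (y (Suc j)))))"
  proof (rule lipschitz_onI)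
    fix s t :: real
    let ?c = "\<lambda>t. max (y j) (min t (y (Suc j)))"
    have "dist (k j * local_worst_fun (y j) (y (Suc j)) \<rho> (?c s)) (k j * local_worst_fun (y j) (y (Suc j)) \<rho> (?c t))
        = cmod (k j) * dist (local_worst_fun (y j) (y (Suc j)) \<rho> (?c s)) (local_worst_fun (y j) (y (Suc j)) \<rho> (?c t))"
      by (simp add: dist_norm flip: norm_mult right_diff_distrib)
    also have "\<dots> \<le> cmod (k j) * (L * dist (?c s) (?c t))"
      using le by (intro mult_left_mono lipschitz_onD[OF L]) auto
    also have "\<dots> \<le> cmod (k j) * (L * dist s t)"
      using lipschitz_on_nonneg[OF L] by (intro mult_left_mono) (auto simp: dist_real_def)
    finally show "dist (k j * local_worst_fun (y j) (y (Suc j)) \<rho> (?c s)) (k j * local_worst_fun (y j) (y (Suc j)) \<rho> (?c t))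
        \<le> cmod (k j) * L * dist s t"
      by (simp add: mult.assoc)
  qed (use lipschitz_on_nonneg[OF L] in simp)
  then show "\<exists>L. L-lipschitz_on U
      (\<lambda>t. k j * local_worst_fun (y j) (y (Suc j)) \<rho> (max (y j) (min t (y (Suc j)))))"
    by blast
qed

text \<open>As a sum of extensions by zero it is square integrable summand by summand. At a
  partition point several summands may contribute, but such points form a finite set.\<close>

definition glued_deriv :: "real \<Rightarrow> complex" where
  "glued_deriv t = (\<Sum>j<m. if t \<in> {y j..y (Suc j)} then k j * worst_deriv (y j) (y (Suc j)) \<rho> t else 0)"

lemma glued_deriv_piece:
  assumes "i < m" and t: "t \<in> {y i<..<y (Suc i)}"
  shows "glued_deriv t = k i * worst_deriv (y i) (y (Suc i)) \<rho> t"
proof -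
  have "(if t \<in> {y j..y (Suc j)} then k j * worst_deriv (y j) (y (Suc j)) \<rho> t else 0)
      = (if j = i then k i * worst_deriv (y i) (y (Suc i)) \<rho> t else 0)" if "j < m" for j
  proof -
    consider "j = i" | "j < i" | "i < j"
      by linarith
    then show ?thesis
    proof cases
      case 2
      then have "y (Suc j) \<le> y i"
        using assms(1) by (intro mono_onD[OF y]) auto
      then show ?thesis
        using 2 t by auto
    next
      case 3
      then have "y (Suc i) \<le> y j"
        using that by (intro mono_onD[OF y]) auto
      then show ?thesis
        using 3 t by auto
    qed (use t in auto)
  qed
  then have "glued_deriv t = (\<Sum>j<m. if j = i then k i * worst_deriv (y i) (y (Suc i)) \<rho> t else 0)"
    unfolding glued_deriv_def by (intro sum.cong) auto
  then show ?thesis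
    using assms(1) by simp
qed

lemma in_L2_worst_deriv_piece:
  assumes "j < m"
  shows "in_L2 (y j) (y (Suc j)) (\<lambda>t. k j * worst_deriv (y j) (y (Suc j)) \<rho> t)"
  by (intro in_L2_cmult in_L2_continuous continuous_on_worst_deriv integrable_piece
      Icc_mono_on_subset(2)[OF y] assms)

lemma in_L2_glued_deriv: "in_L2 (y 0) (y m) glued_deriv"
  unfolding glued_deriv_def[abs_def]
  by (intro in_L2_sum in_L2_extend_zero in_L2_worst_deriv_piece Icc_mono_on_subset(1)[OF y]) auto

lemma glued_worst_fun_has_vector_derivative:
  assumes "t \<in> {y 0<..<y m} - y ` {..m}"
  shows "(glued_worst_fun y m \<rho> k has_vector_derivative glued_deriv t) (at t)"
proof -
  obtain i where i: "i < m" "t \<in> {y i<..<y (Suc i)}"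
    using mem_partition_interior[OF assms] by blast
  show ?thesis
  proof (rule has_vector_derivative_transform_within_open)
    show "((\<lambda>t. k i * local_worst_fun (y i) (y (Suc i)) \<rho> t) has_vector_derivative glued_deriv t) (at t)"
      unfolding glued_deriv_piece[OF i]
      by (intro has_vector_derivative_mult_right local_worst_fun_has_vector_derivative
          Icc_mono_on_subset(2)[OF y] integrable_piece i)
    show "t \<in> {y i<..<y (Suc i)}"
      by (rule i)
    show "k i * local_worst_fun (y i) (y (Suc i)) \<rho> s = glued_worst_fun y m \<rho> k s"
      if "s \<in> {y i<..<y (Suc i)}" for s
      using glued_worst_fun_piece[OF i(1), of s] that by simp
  qed simp
qed

context
  assumes "0 < m"
begin

lemma glued_worst_fun_H10: "glued_worst_fun y m \<rho> k \<in> H10 (y 0) (y m)"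
  and H10_norm_glued_worst_fun_eq: "H10_norm (y 0) (y m) (glued_worst_fun y m \<rho> k) = L2_norm (y 0) (y m) glued_deriv"
proof -
  obtain L where "L-lipschitz_on {y 0..y m} (glued_worst_fun y m \<rho> k)"
    using glued_worst_fun_lipschitz by blast
  note * = H10I_lipschitz[OF this _ glued_worst_fun_has_vector_derivative in_L2_glued_deriv
      glued_worst_fun_partition_point[OF \<open>0 < m\<close>] glued_worst_fun_partition_point[OF \<open>0 < m\<close>]]
  show "glued_worst_fun y m \<rho> k \<in> H10 (y 0) (y m)"
    by (rule *(1)) auto
  show "H10_norm (y 0) (y m) (glued_worst_fun y m \<rho> k) = L2_norm (y 0) (y m) glued_deriv"
    by (rule *(3)) auto
qed

text \<open>The squared norms of the pieces add up. Where the local error is 0, the local function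
  has norm 0 instead of 1, and its weight drops out.\<close>

lemma H10_norm_glued_worst_fun:
  "(H10_norm (y 0) (y m) (glued_worst_fun y m \<rho> k))\<^sup>2
    = (\<Sum>j<m. if initial_error (y j) (y (Suc j)) \<rho> = 0 then 0 else (cmod (k j))\<^sup>2)"
  unfolding H10_norm_glued_worst_fun_eq L2_norm_partition[OF y in_L2_glued_deriv]
proof (rule sum.cong)
  fix j assume "j \<in> {..<m}"
  then have j: "j < m"
    by simp
  note piece = Icc_mono_on_subset(2)[OF y j] integrable_piece[OF j]
  have "L2_norm (y j) (y (Suc j)) glued_deriv
      = L2_norm (y j) (y (Suc j)) (\<lambda>t. k j * worst_deriv (y j) (y (Suc j)) \<rho> t)"
    by (rule L2_norm_cong_finite[OF in_L2_worst_deriv_piece[OF j] finite.emptyI glued_deriv_piece[OF j]]) simp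
  then show "(L2_norm (y j) (y (Suc j)) glued_deriv)\<^sup>2
      = (if initial_error (y j) (y (Suc j)) \<rho> = 0 then 0 else (cmod (k j))\<^sup>2)"
    by (simp add: L2_norm_cmult L2_norm_worst_deriv[OF piece] initial_error_eq[OF piece])
qed simp

lemma weighted_integral_glued_worst_fun:
  "weighted_integral (y 0) (y m) \<rho> (glued_worst_fun y m \<rho> k)
    = (\<Sum>j<m. k j * complex_of_real (initial_error (y j) (y (Suc j)) \<rho>))"
  unfolding weighted_integral_partition[OF y glued_worst_fun_H10 \<rho>]
proof (rule sum.cong)
  fix j assume "j \<in> {..<m}"
  then have j: "j < m"
    by simp
  note piece = Icc_mono_on_subset(2)[OF y j] integrable_piece[OF j]
  have "weighted_integral (y j) (y (Suc j)) \<rho> (glued_worst_fun y m \<rho> k)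
      = (LINT t|lebesgue_on {y j..y (Suc j)}. k j * (local_worst_fun (y j) (y (Suc j)) \<rho> t * \<rho> t))"
    unfolding weighted_integral_def
    by (rule Bochner_Integration.integral_cong) (simp_all add: glued_worst_fun_piece[OF j])
  also have "\<dots> = k j * weighted_integral (y j) (y (Suc j)) \<rho> (local_worst_fun (y j) (y (Suc j)) \<rho>)"
    by (simp add: weighted_integral_def)
  finally show "weighted_integral (y j) (y (Suc j)) \<rho> (glued_worst_fun y m \<rho> k)
      = k j * complex_of_real (initial_error (y j) (y (Suc j)) \<rho>)"
    by (simp add: weighted_integral_local_worst_fun[OF piece] initial_error_eq[OF piece])
qed simp

end

end

subsection \<open>The radius of information\<close>

text \<open>The part on the worst case function assumes a nonzero sum: if all local errors are 0,
  the formula gives the zero function, whose norm is not 1.\<close>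

theorem theorem3:
  fixes \<rho> :: "real \<Rightarrow> complex" and n :: nat and x c :: "nat \<Rightarrow> real"
  assumes "integrable (lebesgue_on {0..1}) \<rho>"
    and "n \<ge> 1"
    and "0 \<le> x 1" and "strict_mono_on {1..n} x" and "x n \<le> 1"
    and "x 0 = 0" and "x (n + 1) = 1"
    and "\<And>j. j \<le> n \<Longrightarrow> c j = initial_error (x j) (x (j + 1)) \<rho>"
  shows "radius \<rho> n (point_info x) = sqrt (\<Sum>j=0..n. (initial_error (x j) (x (j + 1)) \<rho>)\<^sup>2) \<and>
    ((\<Sum>i=0..n. (c i)\<^sup>2) \<noteq> 0 \<longrightarrow>
      (\<exists>f. (\<forall>j\<in>{0..n}. \<forall>t\<in>{x j..x (j + 1)}.
              f t = complex_of_real (1 / sqrt (\<Sum>i=0..n. (c i)\<^sup>2) * c j)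
                      * local_worst_fun (x j) (x (j + 1)) \<rho> t) \<and>
           f \<in> H10 0 1 \<and> H10_norm 0 1 f = 1 \<and> (\<forall>i\<in>{1..n}. point_info x f i = 0) \<and>
           weighted_integral 0 1 \<rho> f = complex_of_real (radius \<rho> n (point_info x))))"
proof -
  \<comment> \<open>With the two ends of the unit interval, \<open>n\<close> sample points give
    \<open>n + 1\<close> pieces.\<close>
  define m where "m = Suc n"
  define e where "e = (\<lambda>j. initial_error (x j) (x (Suc j)) \<rho>)"
  define S where "S = (\<Sum>j<m. (e j)\<^sup>2)"
  \<comment> \<open>Weights proportional to the local errors are the equality case of Cauchy-Schwarz
    for sums. For \<open>S = 0\<close> they are all 0.\<close>
  define k where "k = (\<lambda>j. complex_of_real (1 / sqrt S * e j))"
  define f where "f = glued_worst_fun x m \<rho> k"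
  have "0 < m" and ends: "x 0 = 0" "x m = 1"
    using assms(6,7) by (simp_all add: m_def)
  have S: "(\<Sum>j=0..n. (initial_error (x j) (x (j + 1)) \<rho>)\<^sup>2) = S"
    by (simp add: S_def e_def m_def atLeast0AtMost lessThan_Suc_atMost)
  have Sc: "(\<Sum>i=0..n. (c i)\<^sup>2) = S"
    unfolding S[symmetric] by (rule sum.cong) (simp_all add: assms(8))
  have "S \<ge> 0"
    by (simp add: S_def sum_nonneg)
  \<comment> \<open>The bounds 0 and 1 extend monotonicity from the sample points to
    \<open>x 0\<close> and \<open>x m\<close>, possibly with equality there.\<close>
  have y: "mono_on {..m} x"
  proof (rule mono_onI)
    fix i j assume ij: "i \<in> {..m}" "j \<in> {..m}" "i \<le> j"
    have inner: "x i \<le> x j" if "1 \<le> i" "i \<le> j" "j \<le> n" for i j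
      using strict_mono_on_leD[OF assms(4), of i j] that by simp
    have "0 \<le> x j" if "j \<le> m"
      using inner[of 1 j] assms(2,3) ends that by (cases "j = 0"; cases "j = m") (auto simp: m_def)
    moreover have "x i \<le> 1" if "i \<le> m"
      using inner[of i n] assms(2,5) ends that by (cases "i = 0"; cases "i = m") (auto simp: m_def)
    ultimately show "x i \<le> x j"
      using inner[of i j] ij ends by (cases "i = 0"; cases "j = m") (auto simp: m_def)
  qed
  have \<rho>: "integrable (lebesgue_on {x 0..x m}) \<rho>"
    using assms(1) ends by simp
  have fH: "f \<in> H10 0 1"
    using glued_worst_fun_H10[OF y \<rho> \<open>0 < m\<close>] by (simp add: f_def ends)
  have f0: "f (x i) = 0" if "i \<le> m" for i
    using glued_worst_fun_partition_point[OF y \<rho> \<open>0 < m\<close> that] by (simp add: f_def)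
  have "(H10_norm 0 1 f)\<^sup>2 = (\<Sum>j<m. if e j = 0 then 0 else (cmod (k j))\<^sup>2)"
    using H10_norm_glued_worst_fun[OF y \<rho> \<open>0 < m\<close>, of k] by (simp add: f_def e_def ends)
  \<comment> \<open>The case distinction disappears since \<open>e j = 0\<close> makes the quotient
    0 as well.\<close>
  also have "\<dots> = (\<Sum>j<m. (e j)\<^sup>2 / S)"
    using \<open>S \<ge> 0\<close> by (intro sum.cong) (auto simp: k_def norm_mult norm_divide power_mult_distrib power_divide)
  also have "\<dots> = S / S"
    unfolding sum_divide_distrib[symmetric] S_def[symmetric] ..
  finally have norm_f: "(H10_norm 0 1 f)\<^sup>2 = S / S" .
  have norm_nonneg: "H10_norm 0 1 f \<ge> 0"
    by (simp add: H10_norm_def)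
  have "weighted_integral 0 1 \<rho> f = (\<Sum>j<m. k j * complex_of_real (e j))"
    using weighted_integral_glued_worst_fun[OF y \<rho> \<open>0 < m\<close>, of k] by (simp add: f_def e_def ends)
  also have "\<dots> = complex_of_real (\<Sum>j<m. (e j)\<^sup>2 / sqrt S)"
    by (simp add: k_def power2_eq_square)
  also have "(\<Sum>j<m. (e j)\<^sup>2 / sqrt S) = sqrt S"
    using \<open>S \<ge> 0\<close> by (simp add: S_def[symmetric] real_div_sqrt flip: sum_divide_distrib)
  finally have int_f: "weighted_integral 0 1 \<rho> f = complex_of_real (sqrt S)" .
  have radius: "radius \<rho> n (point_info x) = sqrt S"
    unfolding radius_def
  proof (rule cSup_eq_maximum)
    \<comment> \<open>\<open>S / S\<close> is 1 or, for \<open>S = 0\<close>, 0; so \<open>f\<close>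
      attains the maximum in both cases.\<close>
    have "H10_norm 0 1 f \<le> 1"
      by (rule power2_le_imp_le) (simp_all add: norm_f)
    moreover have "sqrt S = cmod (weighted_integral 0 1 \<rho> f)"
      using \<open>S \<ge> 0\<close> by (simp add: int_f)
    moreover have "\<forall>i\<in>{1..n}. point_info x f i = 0"
      using f0 by (simp add: point_info_def m_def)
    ultimately show "sqrt S \<in> {cmod (weighted_integral 0 1 \<rho> f) |f.
        f \<in> H10 0 1 \<and> H10_norm 0 1 f \<le> 1 \<and> (\<forall>i\<in>{1..n}. point_info x f i = 0)}"
      using fH by blast
  next
    fix r assume "r \<in> {cmod (weighted_integral 0 1 \<rho> f) |f.
        f \<in> H10 0 1 \<and> H10_norm 0 1 f \<le> 1 \<and> (\<forall>i\<in>{1..n}. point_info x f i = 0)}"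
    then obtain g where g: "g \<in> H10 0 1" "H10_norm 0 1 g \<le> 1" "\<forall>i\<in>{1..n}. g (x i) = 0"
      and r: "r = cmod (weighted_integral 0 1 \<rho> g)"
      by (auto simp: point_info_def)
    \<comment> \<open>The information covers the sample points; at the two ends, the boundary
      conditions of \<open>H10\<close> apply.\<close>
    have "g (x i) = 0" if "i \<le> m" for i
      using g(1,3) ends that by (cases "i = 0"; cases "i = m") (auto simp: m_def H10_def)
    then have "r \<le> H10_norm 0 1 g * sqrt S"
      using cmod_weighted_integral_le_partition[OF y _ _ \<rho>, of g] g(1) by (simp add: r ends S_def e_def)
    also have "\<dots> \<le> 1 * sqrt S"
      using g(2) \<open>S \<ge> 0\<close> by (intro mult_right_mono) auto
    finally show "r \<le> sqrt S"
      by simp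
  qed
  have "\<exists>f. (\<forall>j\<in>{0..n}. \<forall>t\<in>{x j..x (j + 1)}.
          f t = complex_of_real (1 / sqrt S * c j) * local_worst_fun (x j) (x (j + 1)) \<rho> t) \<and>
        f \<in> H10 0 1 \<and> H10_norm 0 1 f = 1 \<and> (\<forall>i\<in>{1..n}. point_info x f i = 0) \<and>
        weighted_integral 0 1 \<rho> f = complex_of_real (sqrt S)" if "S \<noteq> 0"
  proof (intro exI conjI ballI)
    fix j t assume "j \<in> {0..n}" "t \<in> {x j..x (j + 1)}"
    then show "f t = complex_of_real (1 / sqrt S * c j) * local_worst_fun (x j) (x (j + 1)) \<rho> t"
      using glued_worst_fun_piece[OF y \<rho>, of j t k] assms(8)[of j] by (simp add: f_def k_def e_def m_def)
  next
    show "H10_norm 0 1 f = 1"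
      using norm_f norm_nonneg that by (simp add: power2_eq_1_iff)
    show "point_info x f i = 0" if "i \<in> {1..n}" for i
      using f0[of i] that by (simp add: point_info_def m_def)
  qed (fact fH int_f)+
  then show ?thesis
    unfolding S Sc radius by blast
qed

end
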